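(* Let $p$ be a prime, $G$ a profinite group and $G(p)$ its maximal pro-$p$ quotient. Then $G$ has the $p$-Kijima--Nishi property if and only if $G(p)$ has the $p$-Kijima--Nishi property.
   Context: For a profinite group $G$, $\mathrm{H}^n(G,\mathbb{F}_p)$ is continuous cohomology with trivial coefficients and $$\mathcal{R}_p(G)=\{\alpha\in \mathrm{H}^1(G,\mathbb{F}_p) : \alpha\smile\beta=0 \text{ for all }\beta\in \mathrm{H}^1(G,\mathbb{F}_p)\}.$$ For an open subgroup $U\le G$, corestriction maps $\mathcal{R}_p(U)$ into $\mathcal{R}_p(G)$, inducing $c_{U,G}:\mathcal{R}_p(U)\to\mathcal{R}_p(G)$. $G$ has the $p$-Kijima--Nishi property if $c_{U,G}$ is surjective for every open normal subgroup $U$ of index $p$. *)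

theory Defs
  imports
    "HOL-Analysis.Analysis"
    "HOL-Algebra.Left_Coset"
    "HOL-Number_Theory.Residues"
begin

section \<open>Profinite groups\<close>

locale topological_group = group G
  for G :: "('a, 'b) monoid_scheme" (structure) and T :: "'a topology" +
  assumes topspace_eq_carrier: "topspace T = carrier G"
    and continuous_map_mult: "continuous_map (prod_topology T T) T (\<lambda>(x, y). x \<otimes> y)"
    and continuous_map_inv: "continuous_map T T (\<lambda>x. inv x)"

locale profinite_group = topological_group G T
  for G :: "('a, 'b) monoid_scheme" (structure) and T :: "'a topology" +
  assumes compact: "compact_space T"
    and Hausdorff: "Hausdorff_space T"
    and totally_disconnected: "\<And>S. connectedin T S \<Longrightarrow> \<exists>a. S \<subseteq> {a}"

locale pro_p_group = profinite_group G T
  for G :: "('a, 'b) monoid_scheme" (structure) and T :: "'a topology" +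
  fixes p :: nat
  assumes index_p_power:
    "\<And>U. U \<lhd> G \<Longrightarrow> openin T U \<Longrightarrow> \<exists>k. card (rcosets U) = p ^ k"

definition quotient_topology :: "'a topology \<Rightarrow> ('a \<Rightarrow> 'c) \<Rightarrow> 'c topology" where
  "quotient_topology X f =
     topology (\<lambda>S. S \<subseteq> f ` topspace X \<and> openin X {x \<in> topspace X. f x \<in> S})"

lemma openin_quotient_topology:
  "openin (quotient_topology X f) S \<longleftrightarrow>
     S \<subseteq> f ` topspace X \<and> openin X {x \<in> topspace X. f x \<in> S}"
proof -
  have "istopology (\<lambda>S. S \<subseteq> f ` topspace X \<and> openin X {x \<in> topspace X. f x \<in> S})"
    unfolding istopology_def
  proof (intro conjI allI impI)
    fix S S' assume "S \<subseteq> f ` topspace X \<and> openin X {x \<in> topspace X. f x \<in> S}"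
      and "S' \<subseteq> f ` topspace X \<and> openin X {x \<in> topspace X. f x \<in> S'}"
    moreover have "{x \<in> topspace X. f x \<in> S \<inter> S'} =
        {x \<in> topspace X. f x \<in> S} \<inter> {x \<in> topspace X. f x \<in> S'}" by auto
    ultimately show "S \<inter> S' \<subseteq> f ` topspace X" "openin X {x \<in> topspace X. f x \<in> S \<inter> S'}"
      by (auto intro: openin_Int)
  next
    fix \<K> assume "\<forall>K\<in>\<K>. K \<subseteq> f ` topspace X \<and> openin X {x \<in> topspace X. f x \<in> K}"
    moreover have "{x \<in> topspace X. f x \<in> \<Union>\<K>} = (\<Union>K\<in>\<K>. {x \<in> topspace X. f x \<in> K})" by auto
    ultimately show "\<Union>\<K> \<subseteq> f ` topspace X" "openin X {x \<in> topspace X. f x \<in> \<Union>\<K>}"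
      by auto
  qed
  then show ?thesis
    by (simp add: quotient_topology_def)
qed

lemma quotient_map_quotient_topology: "quotient_map X (quotient_topology X f) f"
proof -
  have "{x \<in> topspace X. f x \<in> f ` topspace X} = topspace X" by auto
  then have "openin (quotient_topology X f) (f ` topspace X)"
    by (simp add: openin_quotient_topology)
  then have "topspace (quotient_topology X f) = f ` topspace X"
    by (meson openin_quotient_topology openin_subset openin_topspace subset_antisym)
  then show ?thesis
    by (auto simp: quotient_map_def openin_quotient_topology)
qed

definition pro_p_kernel :: "nat \<Rightarrow> ('a, 'b) monoid_scheme \<Rightarrow> 'a topology \<Rightarrow> 'a set" where
  "pro_p_kernel p G T =
     \<Inter>{N. N \<lhd> G \<and> closedin T N \<and>
         pro_p_group (G Mod N) (quotient_topology T (\<lambda>g. N #>\<^bsub>G\<^esub> g)) p}"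

definition max_pro_p_quotient :: "nat \<Rightarrow> ('a, 'b) monoid_scheme \<Rightarrow> 'a topology \<Rightarrow> 'a set monoid" where
  "max_pro_p_quotient p G T = G Mod pro_p_kernel p G T"

definition max_pro_p_quotient_topology ::
    "nat \<Rightarrow> ('a, 'b) monoid_scheme \<Rightarrow> 'a topology \<Rightarrow> 'a set topology" where
  "max_pro_p_quotient_topology p G T = quotient_topology T (\<lambda>g. pro_p_kernel p G T #>\<^bsub>G\<^esub> g)"

section \<open>Continuous cohomology with trivial coefficients\<close>

text \<open>
  The coefficients are the additive group of a commutative ring \<open>R\<close>, discrete and with trivial
  action of the group. Cohomology is computed from the continuous homogeneous cochains
  \<open>x(g\<^sub>0, \<dots>, g\<^sub>n)\<close>, so an \<open>n\<close>-cochain is a function of \<open>n + 1\<close> group elements. Cochains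
  are extensional functions, so that equality of cochains is equality on tuples of group elements.
\<close>

definition tuples :: "nat \<Rightarrow> 'a set \<Rightarrow> (nat \<Rightarrow> 'a) set" where
  "tuples n S = {..n} \<rightarrow>\<^sub>E S"

definition translate :: "('a, 'b) monoid_scheme \<Rightarrow> nat \<Rightarrow> 'a \<Rightarrow> (nat \<Rightarrow> 'a) \<Rightarrow> nat \<Rightarrow> 'a" where
  "translate G n g x = (\<lambda>i\<in>{..n}. g \<otimes>\<^bsub>G\<^esub> x i)"

text \<open>
  For a subgroup \<open>U\<close> of \<open>G\<close>, the following are the \<open>U\<close>-invariant continuous functions on all of
  \<open>G\<^sup>n\<^sup>+\<^sup>1\<close>. Those with \<open>U = G\<close> compute the cohomology of \<open>G\<close>; the
  other ones are needed for the corestriction.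
\<close>

definition cochains ::
    "('r, 'm) ring_scheme \<Rightarrow> nat \<Rightarrow> ('a, 'b) monoid_scheme \<Rightarrow> 'a topology \<Rightarrow> 'a set
      \<Rightarrow> ((nat \<Rightarrow> 'a) \<Rightarrow> 'r) set" where
  "cochains R n G T U =
     {f \<in> tuples n (carrier G) \<rightarrow>\<^sub>E carrier R.
        continuous_map (product_topology (\<lambda>_. T) {..n}) (discrete_topology (carrier R)) f \<and>
        (\<forall>u\<in>U. \<forall>x\<in>tuples n (carrier G). f (translate G n u x) = f x)}"

text \<open>\<open>face n i\<close> omits the \<open>i\<close>-th entry of an \<open>(n + 2)\<close>-tuple.\<close>

definition face :: "nat \<Rightarrow> nat \<Rightarrow> (nat \<Rightarrow> 'a) \<Rightarrow> nat \<Rightarrow> 'a" where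
  "face n i x = (\<lambda>j\<in>{..n}. x (if j < i then j else Suc j))"

definition differential ::
    "('r, 'm) ring_scheme \<Rightarrow> nat \<Rightarrow> ('a, 'b) monoid_scheme
      \<Rightarrow> ((nat \<Rightarrow> 'a) \<Rightarrow> 'r) \<Rightarrow> (nat \<Rightarrow> 'a) \<Rightarrow> 'r" where
  "differential R n G f =
     (\<lambda>x\<in>tuples (Suc n) (carrier G).
        \<Oplus>\<^bsub>R\<^esub>i\<in>{..Suc n}. if even i then f (face n i x) else \<ominus>\<^bsub>R\<^esub> f (face n i x))"

definition zero_cochain ::
    "('r, 'm) ring_scheme \<Rightarrow> nat \<Rightarrow> ('a, 'b) monoid_scheme \<Rightarrow> (nat \<Rightarrow> 'a) \<Rightarrow> 'r" where
  "zero_cochain R n G = (\<lambda>x\<in>tuples n (carrier G). \<zero>\<^bsub>R\<^esub>)"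

definition cocycles ::
    "('r, 'm) ring_scheme \<Rightarrow> nat \<Rightarrow> ('a, 'b) monoid_scheme \<Rightarrow> 'a topology \<Rightarrow> 'a set
      \<Rightarrow> ((nat \<Rightarrow> 'a) \<Rightarrow> 'r) set" where
  "cocycles R n G T U =
     {f \<in> cochains R n G T U. differential R n G f = zero_cochain R (Suc n) G}"

definition coboundaries ::
    "('r, 'm) ring_scheme \<Rightarrow> nat \<Rightarrow> ('a, 'b) monoid_scheme \<Rightarrow> 'a topology \<Rightarrow> 'a set
      \<Rightarrow> ((nat \<Rightarrow> 'a) \<Rightarrow> 'r) set" where
  "coboundaries R n G T U =
     (case n of 0 \<Rightarrow> {zero_cochain R 0 G} | Suc m \<Rightarrow> differential R m G ` cochains R m G T U)"

definition cocycle_group ::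
    "('r, 'm) ring_scheme \<Rightarrow> nat \<Rightarrow> ('a, 'b) monoid_scheme \<Rightarrow> 'a topology
      \<Rightarrow> ((nat \<Rightarrow> 'a) \<Rightarrow> 'r) monoid" where
  "cocycle_group R n G T =
     \<lparr>carrier = cocycles R n G T (carrier G),
      monoid.mult = (\<lambda>f g. \<lambda>x\<in>tuples n (carrier G). f x \<oplus>\<^bsub>R\<^esub> g x),
      one = zero_cochain R n G\<rparr>"

text \<open>The cohomology group \<open>H\<^sup>n(G, R)\<close>, written multiplicatively: its zero class is the unit.\<close>

definition cohomology ::
    "('r, 'm) ring_scheme \<Rightarrow> nat \<Rightarrow> ('a, 'b) monoid_scheme \<Rightarrow> 'a topology
      \<Rightarrow> ((nat \<Rightarrow> 'a) \<Rightarrow> 'r) set monoid" where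
  "cohomology R n G T = cocycle_group R n G T Mod coboundaries R n G T (carrier G)"

definition cohomology_class ::
    "('r, 'm) ring_scheme \<Rightarrow> nat \<Rightarrow> ('a, 'b) monoid_scheme \<Rightarrow> 'a topology
      \<Rightarrow> ((nat \<Rightarrow> 'a) \<Rightarrow> 'r) \<Rightarrow> ((nat \<Rightarrow> 'a) \<Rightarrow> 'r) set" where
  "cohomology_class R n G T f =
     coboundaries R n G T (carrier G) #>\<^bsub>cocycle_group R n G T\<^esub> f"

section \<open>Cup product\<close>

definition cup_cochain ::
    "('r, 'm) ring_scheme \<Rightarrow> nat \<Rightarrow> nat \<Rightarrow> ('a, 'b) monoid_scheme
      \<Rightarrow> ((nat \<Rightarrow> 'a) \<Rightarrow> 'r) \<Rightarrow> ((nat \<Rightarrow> 'a) \<Rightarrow> 'r) \<Rightarrow> (nat \<Rightarrow> 'a) \<Rightarrow> 'r" where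
  "cup_cochain R m n G f g =
     (\<lambda>x\<in>tuples (m + n) (carrier G). f (\<lambda>i\<in>{..m}. x i) \<otimes>\<^bsub>R\<^esub> g (\<lambda>i\<in>{..n}. x (m + i)))"

text \<open>
  The union runs over all representatives of the two classes; they all give the same class,
  which is therefore the value of the union.
\<close>

definition cup ::
    "('r, 'm) ring_scheme \<Rightarrow> nat \<Rightarrow> nat \<Rightarrow> ('a, 'b) monoid_scheme \<Rightarrow> 'a topology
      \<Rightarrow> ((nat \<Rightarrow> 'a) \<Rightarrow> 'r) set \<Rightarrow> ((nat \<Rightarrow> 'a) \<Rightarrow> 'r) set \<Rightarrow> ((nat \<Rightarrow> 'a) \<Rightarrow> 'r) set" where
  "cup R m n G T \<alpha> \<beta> =
     (\<Union>f\<in>\<alpha>. \<Union>g\<in>\<beta>. cohomology_class R (m + n) G T (cup_cochain R m n G f g))"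

section \<open>Corestriction\<close>

text \<open>
  The norm of a \<open>U\<close>-invariant cochain \<open>f\<close> is the sum of the translates \<open>\<sigma>f\<close> over
  \<open>\<sigma>U \<in> G/U\<close>, where \<open>(\<sigma>f)(x) = f(\<sigma>\<^sup>-\<^sup>1x)\<close>. By invariance of \<open>f\<close> the
  chosen coset representatives do not matter.
\<close>

definition norm_cochain ::
    "('r, 'm) ring_scheme \<Rightarrow> nat \<Rightarrow> ('a, 'b) monoid_scheme \<Rightarrow> 'a set
      \<Rightarrow> ((nat \<Rightarrow> 'a) \<Rightarrow> 'r) \<Rightarrow> (nat \<Rightarrow> 'a) \<Rightarrow> 'r" where
  "norm_cochain R n G U f =
     (\<lambda>x\<in>tuples n (carrier G).
        \<Oplus>\<^bsub>R\<^esub>S\<in>lcosets\<^bsub>G\<^esub> U. f (translate G n (inv\<^bsub>G\<^esub> (SOME s. s \<in> S)) x))"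

text \<open>
  For \<open>U\<close> open in \<open>G\<close>, restriction of functions from \<open>G\<^sup>n\<^sup>+\<^sup>1\<close> to
  \<open>U\<^sup>n\<^sup>+\<^sup>1\<close> identifies the cohomology of the complex of \<open>U\<close>-invariant cochains on
  \<open>G\<close> with the cohomology of \<open>U\<close>. Under this identification, corestriction is induced by the
  norm. Again the union is over all representatives, which give the same class.
\<close>

definition corestriction ::
    "('r, 'm) ring_scheme \<Rightarrow> nat \<Rightarrow> ('a, 'b) monoid_scheme \<Rightarrow> 'a topology \<Rightarrow> 'a set
      \<Rightarrow> ((nat \<Rightarrow> 'a) \<Rightarrow> 'r) set \<Rightarrow> ((nat \<Rightarrow> 'a) \<Rightarrow> 'r) set" where
  "corestriction R n G T U \<alpha> =
     (\<Union>f\<in>{f \<in> cocycles R n G T U. restrict f (tuples n U) \<in> \<alpha>}.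
        cohomology_class R n G T (norm_cochain R n G U f))"

section \<open>The Kijima--Nishi property\<close>

definition cup_radical ::
    "nat \<Rightarrow> ('a, 'b) monoid_scheme \<Rightarrow> 'a topology \<Rightarrow> ((nat \<Rightarrow> 'a) \<Rightarrow> int) set set" where
  "cup_radical p G T =
     {\<alpha> \<in> carrier (cohomology (residue_ring (int p)) 1 G T).
        \<forall>\<beta>\<in>carrier (cohomology (residue_ring (int p)) 1 G T).
          cup (residue_ring (int p)) 1 1 G T \<alpha> \<beta> = \<one>\<^bsub>cohomology (residue_ring (int p)) 2 G T\<^esub>}"

definition Kijima_Nishi ::
    "nat \<Rightarrow> ('a, 'b) monoid_scheme \<Rightarrow> 'a topology \<Rightarrow> bool" where
  "Kijima_Nishi p G T \<longleftrightarrow>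
     (\<forall>U. U \<lhd> G \<longrightarrow> openin T U \<longrightarrow> card (rcosets\<^bsub>G\<^esub> U) = p \<longrightarrow>
        corestriction (residue_ring (int p)) 1 G T U ` cup_radical p (G\<lparr>carrier := U\<rparr>) (subtopology T U)
          = cup_radical p G T)"

end

theory Submission
  imports Defs "HOL-Algebra.Sylow" "HOL-Algebra.SndIsomorphismGrp"
begin

text \<open>
  Let \<open>K\<close> be the kernel of \<open>q: G \<rightarrow> G(p)\<close>. It has no nontrivial continuous homomorphism to
  \<open>\<int>/p\<close>: the intersection of the conjugates of its kernel would give a pro-\<open>p\<close> quotient of \<open>G\<close>
  larger than \<open>G(p)\<close>. For an open subgroup \<open>U \<supseteq> K\<close> this implies that every \<open>U\<close>-invariant
  1-cocycle on \<open>G\<close> factors through \<open>q\<close>, and that a cup product of inflated 1-cocycles of \<open>U\<close> is a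
  coboundary only if it already is one on \<open>q(U)\<close>. Open normal subgroups of index \<open>p\<close> contain \<open>K\<close>, so
  inflation identifies the radicals and the corestriction maps of \<open>G\<close> with those of \<open>G(p)\<close>.
\<close>

section \<open>Profinite groups and the maximal pro-\<open>p\<close> quotient\<close>

text \<open>If H^1(K) = 0, the five-term sequence makes inflation along \<open>q\<close> an
  isomorphism on H^1 and injective on H^2. Here one statement on cochains plays both parts: a
  degree-one cochain, invariant under a subgroup containing \<open>K\<close>, is inflated as soon as
  it satisfies the cocycle identity on triples with two neighbouring entries in the same coset of
  \<open>K\<close>. Cocycles are of this kind. So is a cochain bounding a cup product of inflated
  cocycles, because that product vanishes on such triples.

  The corestriction requires the same comparison for an open subgroup U, whose own maximal pro-p
  quotient might a priori have another kernel. The comparison is therefore made along U -> q(U),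
  whose kernel is still \<open>K\<close>: what it uses is a property of \<open>K\<close> and not of
  U.

  The kernel is defined by closed normal subgroups with pro-p quotient, but compactness arguments
  need open ones. It is first rewritten as the intersection of the open normal subgroups of p-power
  index.\<close>

lemma (in group) order_eq_prime_power:
  assumes "prime p" and fin: "finite (carrier G)"
    and pow: "\<And>x. x \<in> carrier G \<Longrightarrow> \<exists>k::nat. x [^] (p ^ k) = \<one>"
  shows "\<exists>k. order G = p ^ k"
proof -
  have "order G > 0"
    using fin order_gt_0_iff_finite by blast
  then obtain k m where m: "order G = p ^ k * m" "\<not> p dvd m"
    using multiplicity_decompose'[of "order G" p] not_prime_unit assms(1) by (metis less_numeral_extra(3))
  have "m = 1"
  proof (rule ccontr)
    assume "m \<noteq> 1"
    then obtain q where q: "prime q" "q dvd m"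
      using prime_factor_nat by blast
    \<comment> \<open>Sylow's theorem with exponent 1 is Cauchy's theorem. The order of a nontrivial
      element of the resulting subgroup divides both \<open>q\<close> and a power of
      \<open>p\<close>, which is impossible.\<close>
    then have "order G = q ^ 1 * (order G div q)"
      using m(1) by simp
    then obtain H where H: "subgroup H G" "card H = q ^ 1"
      using sylow_thm[OF q(1) is_group _ fin] by blast
    then interpret H: subgroup H G by simp
    have "\<not> H \<subseteq> {\<one>}"
      using H(2) prime_gt_1_nat[OF q(1)] card_mono[of "{\<one>}" H] by auto
    then obtain x where x: "x \<in> H" "x \<noteq> \<one>"
      by blast
    have "x [^]\<^bsub>G\<lparr>carrier := H\<rparr>\<^esub> order (G\<lparr>carrier := H\<rparr>) = \<one>\<^bsub>G\<lparr>carrier := H\<rparr>\<^esub>"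
      using x H.subgroup_is_group[OF is_group] by (intro group.pow_order_eq_1) auto
    then have "x [^] q = \<one>"
      using H(2) by (simp add: order_def nat_pow_consistent [symmetric])
    moreover obtain j where "x [^] (p ^ j) = \<one>"
      using pow[OF H.mem_carrier[OF x(1)]] by blast
    ultimately have "ord x dvd q" "ord x dvd p ^ j"
      using x(1) pow_eq_id by auto
    moreover have "q \<noteq> p"
      using m(2) q(2) by blast
    then have "coprime q (p ^ j)"
      using primes_coprime[OF q(1) assms(1)] by simp
    ultimately have "ord x = 1"
      using coprime_common_divisor_nat by blast
    then show False
      using ord_eq_1 x by auto
  qed
  then show ?thesis
    using m(1) by auto
qed

text \<open>Trades the index for a condition on single elements, which passes to intersections,
  preimages and products without any counting of cosets.\<close>

lemma (in normal) rcosets_index_prime_power_iff: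
  assumes "prime p" and "finite (rcosets H)"
  shows "(\<exists>k. card (rcosets H) = p ^ k) \<longleftrightarrow> (\<forall>x\<in>carrier G. \<exists>k. x [^] (p ^ k) \<in> H)"
proof -
  interpret Q: group "G Mod H"
    by (rule factorgroup_is_group)
  have carr: "carrier (G Mod H) = rcosets H" and one: "\<one>\<^bsub>G Mod H\<^esub> = H"
    by (simp_all add: FactGroup_def)
  have *: "(H #> x) [^]\<^bsub>G Mod H\<^esub> n = H \<longleftrightarrow> x [^] n \<in> H" if "x \<in> carrier G" for x and n :: nat
    using that coset_join1[OF _ nat_pow_closed[OF that] subgroup_axioms]
      coset_join2[OF nat_pow_closed[OF that] subgroup_axioms]
    unfolding FactGroup_pow[OF that] by blast
  show ?thesis
  proof
    assume "\<exists>k. card (rcosets H) = p ^ k"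
    then obtain k where k: "order (G Mod H) = p ^ k"
      by (auto simp: order_def carr)
    have "x [^] (p ^ k) \<in> H" if "x \<in> carrier G" for x
      using that *[OF that, of "p ^ k"] Q.pow_order_eq_1[of "H #> x"] k
      by (auto simp: carr one rcosetsI subset)
    then show "\<forall>x\<in>carrier G. \<exists>k. x [^] (p ^ k) \<in> H"
      by blast
  next
    assume "\<forall>x\<in>carrier G. \<exists>k. x [^] (p ^ k) \<in> H"
    then have "\<exists>k::nat. y [^]\<^bsub>G Mod H\<^esub> (p ^ k) = \<one>\<^bsub>G Mod H\<^esub>" if "y \<in> carrier (G Mod H)" for y
      using that * by (auto simp: carr one RCOSETS_def)
    then show "\<exists>k. card (rcosets H) = p ^ k"
      using Q.order_eq_prime_power[OF assms(1)] assms(2) by (auto simp: order_def carr)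
  qed
qed

section \<open>Open subgroups of topological groups\<close>

context topological_group
begin

lemma continuous_map_mult_left:
  assumes "g \<in> carrier G" shows "continuous_map T T (\<lambda>x. g \<otimes> x)"
proof -
  have "continuous_map T (prod_topology T T) (\<lambda>x. (g, x))"
    using assms by (intro continuous_map_pairedI) (auto simp: topspace_eq_carrier)
  from continuous_map_compose[OF this continuous_map_mult] show ?thesis
    by (simp add: o_def)
qed

lemma continuous_map_mult_right:
  assumes "g \<in> carrier G" shows "continuous_map T T (\<lambda>x. x \<otimes> g)"
proof -
  have "continuous_map T (prod_topology T T) (\<lambda>x. (x, g))"
    using assms by (intro continuous_map_pairedI) (auto simp: topspace_eq_carrier)
  from continuous_map_compose[OF this continuous_map_mult] show ?thesis
    by (simp add: o_def)
qed

lemma openin_r_coset: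
  assumes "openin T W" "g \<in> carrier G" shows "openin T (W #> g)"
proof -
  have W: "W \<subseteq> carrier G"
    using assms(1) openin_subset topspace_eq_carrier by blast
  have "W #> g = {x \<in> topspace T. x \<otimes> inv g \<in> W}"
  proof (intro equalityI subsetI)
    fix x assume "x \<in> {x \<in> topspace T. x \<otimes> inv g \<in> W}"
    then have "x = x \<otimes> inv g \<otimes> g" "x \<otimes> inv g \<in> W"
      using assms(2) by (simp_all add: topspace_eq_carrier m_assoc)
    then show "x \<in> W #> g"
      unfolding r_coset_def by blast
  qed (use assms(2) W in \<open>auto simp: r_coset_def topspace_eq_carrier m_assoc subset_iff\<close>)
  then show ?thesis
    using assms continuous_map_mult_right[of "inv g"] by (simp add: openin_continuous_map_preimage)
qed

lemma openin_subgroup: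
  assumes H: "subgroup H G" and W: "openin T W" "\<one> \<in> W" "W \<subseteq> H"
  shows "openin T H"
proof -
  have "\<exists>B. openin T B \<and> h \<in> B \<and> B \<subseteq> H" if h: "h \<in> H" for h
  proof (intro exI conjI)
    have hG: "h \<in> carrier G"
      using h H by (simp add: subgroup.mem_carrier)
    then show "openin T (W #> h)"
      using W(1) by (intro openin_r_coset)
    show "h \<in> W #> h"
      using W(2) hG unfolding r_coset_def by (auto intro!: bexI[of _ \<one>])
    show "W #> h \<subseteq> H"
      using W(3) H h by (auto simp: r_coset_def subgroup.m_closed)
  qed
  then show ?thesis
    by (subst openin_subopen) blast
qed

lemma closedin_open_subgroup:
  assumes H: "subgroup H G" and op: "openin T H"
  shows "closedin T H"
proof -
  have "openin T (carrier G - H)"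
  proof (subst openin_subopen, intro ballI)
    fix x assume x: "x \<in> carrier G - H"
    have "H #> x \<subseteq> carrier G - H"
    proof
      fix y assume y: "y \<in> H #> x"
      then obtain h where h: "h \<in> H" "y = h \<otimes> x"
        by (auto simp: r_coset_def)
      have "x = inv h \<otimes> y"
        using x h H by (simp add: m_assoc[symmetric] subgroup.mem_carrier)
      then show "y \<in> carrier G - H"
        using x h H by (metis Diff_iff m_closed subgroup.m_closed subgroup.m_inv_closed subgroup.mem_carrier)
    qed
    then show "\<exists>B. openin T B \<and> x \<in> B \<and> B \<subseteq> carrier G - H"
      using x H openin_r_coset[OF op, of x] rcos_self by blast
  qed
  then show ?thesis
    using H by (simp add: closedin_def topspace_eq_carrier subgroup.subset)
qed

end

section \<open>Consequences of compactness\<close>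

context profinite_group
begin

text \<open>The cosets form an open cover by disjoint nonempty sets, so a finite subcover cannot
  omit any of them.\<close>

lemma finite_rcosets_open_subgroup:
  assumes H: "subgroup H G" and op: "openin T H"
  shows "finite (rcosets H)"
proof -
  have "\<forall>U\<in>rcosets H. openin T U"
    using op openin_r_coset by (auto simp: RCOSETS_def)
  moreover have "\<Union>(rcosets H) = topspace T"
    using H rcosets_part_G topspace_eq_carrier by simp
  ultimately obtain \<F> where F: "finite \<F>" "\<F> \<subseteq> rcosets H" "\<Union>\<F> = topspace T"
    using compact unfolding compact_space by meson
  have "R \<in> \<F>" if R: "R \<in> rcosets H" for R
  proof -
    obtain x where x: "x \<in> R" "x \<in> topspace T"
      using subgroup.rcosets_non_empty[OF H R] \<open>\<Union>(rcosets H) = topspace T\<close> R by blast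
    then obtain R' where R': "R' \<in> \<F>" "x \<in> R'"
      using F(3) by blast
    then have "R = R'"
      using R F(2) x(1) rcos_disjoint[OF H] by (meson disjnt_iff pairwiseD subsetD)
    with R' show ?thesis by simp
  qed
  then show ?thesis
    using F(1) by (meson finite_subset subsetI)
qed

text \<open>A form of the tube lemma: the complement is the projection of a closed set along a
  compact factor, hence closed.\<close>

lemma openin_forall_compact:
  assumes "openin (prod_topology T T) W"
  shows "openin T {x \<in> carrier G. \<forall>y\<in>carrier G. (x, y) \<in> W}"
proof -
  let ?C = "carrier G \<times> carrier G - W"
  have "closedin (prod_topology T T) ?C"
    using assms by (metis closedin_def closedin_topspace openin_closedin_eq topspace_eq_carrier topspace_prod_topology double_diff openin_subset Diff_subset)
  then have "closedin T (fst ` ?C)"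
    using closed_map_fst[OF compact] by (auto simp: closed_map_def)
  then have "openin T (topspace T - fst ` ?C)"
    by blast
  moreover have "topspace T - fst ` ?C = {x \<in> carrier G. \<forall>y\<in>carrier G. (x, y) \<in> W}"
    by (force simp: topspace_eq_carrier)
  ultimately show ?thesis
    by simp
qed

text \<open>
  In a compact Hausdorff totally disconnected space \<open>\<one>\<close> has a clopen neighbourhood \<open>C \<subseteq> W\<close>. The
  stabilizer of \<open>C\<close> under left translation is a subgroup contained in \<open>C\<close>, and both it and its
  normal core are open, because projections along compact spaces are closed maps.
\<close>

lemma open_normal_subgroup_basis:
  assumes "openin T W" "\<one> \<in> W"
  obtains V where "V \<lhd> G" "openin T V" "V \<subseteq> W"
proof -
  have one_top: "\<one> \<in> topspace T"
    by (simp add: topspace_eq_carrier)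
  then obtain a where "connected_component_of_set T \<one> \<subseteq> {a}"
    using totally_disconnected connectedin_connected_component_of by metis
  then have "connected_component_of_set T \<one> = {\<one>}"
    using one_top connected_component_of_refl[of T \<one>] by blast
  then have "{\<one>} \<in> connected_components_of T"
    using one_top by (metis connected_component_in_connected_components_of)
  moreover have "compactin T {\<one>}"
    using one_top by simp
  \<comment> \<open>In a compact Hausdorff space a component has arbitrarily small clopen
    neighbourhoods; \<open>D\<close> is the complement of \<open>C\<close>, and its openness is used
    below.\<close>
  ultimately obtain C D where C: "openin T C" "\<one> \<in> C" "C \<subseteq> W"
    and D: "openin T D" "disjnt C D" "C \<union> D = topspace T"
    using wilder_locally_compact_component_thm[of T "{\<one>}" W] assms compact Hausdorff
      compact_imp_locally_compact_space by (metis empty_subsetI insert_subset)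
  have CG: "C \<subseteq> carrier G"
    using C(1) openin_subset topspace_eq_carrier by blast
  define P where "P = {g \<in> carrier G. \<forall>c\<in>C. g \<otimes> c \<in> C}"
  have "openin T P"
  proof -
    \<comment> \<open>Adding \<open>topspace T \<times> D\<close> makes the condition void for y
      outside \<open>C\<close>, so the quantifier over \<open>C\<close> becomes one over the whole
      compact group.\<close>
    let ?W = "{z \<in> topspace (prod_topology T T). (case z of (x, y) \<Rightarrow> x \<otimes> y) \<in> C}
      \<union> topspace T \<times> D"
    have W: "openin (prod_topology T T) ?W"
      using C(1) D(1) continuous_map_mult
      by (intro openin_Un openin_continuous_map_preimage) (auto simp: openin_prod_Times_iff)
    have P: "P = {x \<in> carrier G. \<forall>y\<in>carrier G. (x, y) \<in> ?W}"
    proof (intro equalityI subsetI)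
      fix x assume x: "x \<in> {x \<in> carrier G. \<forall>y\<in>carrier G. (x, y) \<in> ?W}"
      have "x \<otimes> c \<in> C" if "c \<in> C" for c
      proof -
        have "(x, c) \<in> ?W" "c \<notin> D"
          using x that CG D(2) by (auto simp: disjnt_iff)
        then show ?thesis
          by simp
      qed
      with x show "x \<in> P"
        by (simp add: P_def)
    next
      fix x assume x: "x \<in> P"
      have "(x, y) \<in> ?W" if "y \<in> carrier G" for y
      proof (cases "y \<in> C")
        case False
        then have "y \<in> D"
          using D(3) that by (auto simp: topspace_eq_carrier)
        then show ?thesis
          using x by (simp add: P_def topspace_eq_carrier)
      qed (use x that in \<open>simp add: P_def topspace_eq_carrier\<close>)
      then show "x \<in> {x \<in> carrier G. \<forall>y\<in>carrier G. (x, y) \<in> ?W}"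
        using x by (simp add: P_def)
    qed
    show ?thesis
      unfolding P by (rule openin_forall_compact[OF W])
  qed
  \<comment> \<open>Membership in \<open>P\<close> only gives g C \<subseteq> C; imposing it on the
    inverse as well gives g C = C, which is stable under inversion.\<close>
  define H where "H = P \<inter> {x \<in> topspace T. inv x \<in> P}"
  have "openin T H"
    unfolding H_def using \<open>openin T P\<close> continuous_map_inv
    by (intro openin_Int openin_continuous_map_preimage) auto
  have "subgroup H G"
  proof (rule subgroupI)
    show "H \<subseteq> carrier G"
      by (auto simp: H_def P_def)
    have "\<one> \<in> H"
      using CG by (auto simp: H_def P_def topspace_eq_carrier)
    then show "H \<noteq> {}"
      by blast
    show "inv x \<in> H" if "x \<in> H" for x
      using that by (auto simp: H_def P_def topspace_eq_carrier)
    have "x \<otimes> y \<in> P" if "x \<in> P" "y \<in> P" for x y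
      using that CG by (auto simp: P_def m_assoc subset_iff)
    then show "x \<otimes> y \<in> H" if "x \<in> H" "y \<in> H" for x y
      using that by (auto simp: H_def topspace_eq_carrier inv_mult_group)
  qed
  note H_closed [simp] = subgroup.one_closed[OF \<open>subgroup H G\<close>]
    subgroup.m_closed[OF \<open>subgroup H G\<close>] subgroup.m_inv_closed[OF \<open>subgroup H G\<close>]
  have "H \<subseteq> C"
  proof
    fix x assume "x \<in> H"
    then have "x \<in> carrier G" "x \<otimes> \<one> \<in> C"
      using C(2) by (auto simp: H_def P_def)
    then show "x \<in> C"
      by simp
  qed
  define V where "V = {x \<in> carrier G. \<forall>g\<in>carrier G. g \<otimes> x \<otimes> inv g \<in> H}"
  have "openin T V"
  proof -
    let ?f = "\<lambda>z. snd z \<otimes> fst z \<otimes> inv (snd z)"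
    let ?T2 = "prod_topology T T"
    have mult: "continuous_map ?T2 T (\<lambda>z. f z \<otimes> g z)"
      if "continuous_map ?T2 T f" "continuous_map ?T2 T g" for f g
      using continuous_map_compose[OF continuous_map_pairedI[OF that] continuous_map_mult]
      by (simp add: o_def)
    have inv: "continuous_map ?T2 T (\<lambda>z. inv (f z))" if "continuous_map ?T2 T f" for f
      using continuous_map_compose[OF that continuous_map_inv] by (simp add: o_def)
    have "continuous_map ?T2 T ?f"
      by (intro mult inv continuous_map_fst continuous_map_snd)
    then have W: "openin ?T2 {z \<in> topspace ?T2. ?f z \<in> H}"
      using \<open>openin T H\<close> by (rule openin_continuous_map_preimage)
    have V: "V = {x \<in> carrier G. \<forall>y\<in>carrier G. (x, y) \<in> {z \<in> topspace ?T2. ?f z \<in> H}}"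
      by (auto simp: V_def topspace_eq_carrier)
    show ?thesis
      unfolding V by (rule openin_forall_compact[OF W])
  qed
  moreover have "V \<lhd> G"
  proof (rule normal_invI)
    show "subgroup V G"
    proof (rule subgroupI)
      show "V \<subseteq> carrier G"
        by (auto simp: V_def)
      have "\<one> \<in> V"
        by (auto simp: V_def)
      then show "V \<noteq> {}"
        by blast
      show "inv x \<in> V" if x: "x \<in> V" for x
      proof -
        have "g \<otimes> inv x \<otimes> inv g = inv (g \<otimes> x \<otimes> inv g)" if "g \<in> carrier G" for g
          using x that by (simp add: V_def inv_mult_group m_assoc)
        then show ?thesis
          using x by (auto simp: V_def)
      qed
      show "x \<otimes> y \<in> V" if xy: "x \<in> V" "y \<in> V" for x y
      proof -
        have "g \<otimes> (x \<otimes> y) \<otimes> inv g = (g \<otimes> x \<otimes> inv g) \<otimes> (g \<otimes> y \<otimes> inv g)"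
          if "g \<in> carrier G" for g
        proof -
          have "inv g \<otimes> (g \<otimes> (y \<otimes> inv g)) = y \<otimes> inv g"
            using xy that by (simp add: V_def m_assoc[symmetric])
          then show ?thesis
            using xy that by (simp add: V_def m_assoc)
        qed
        then show ?thesis
          using xy by (auto simp: V_def)
      qed
    qed
    show "x \<otimes> h \<otimes> inv x \<in> V" if "x \<in> carrier G" "h \<in> V" for x h
    proof -
      have "g \<otimes> (x \<otimes> h \<otimes> inv x) \<otimes> inv g = (g \<otimes> x) \<otimes> h \<otimes> inv (g \<otimes> x)" if "g \<in> carrier G" for g
        using \<open>x \<in> carrier G\<close> \<open>h \<in> V\<close> that by (simp add: V_def inv_mult_group m_assoc)
      then show ?thesis
        using that by (auto simp: V_def)
    qed
  qed
  moreover have "V \<subseteq> W"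
  proof -
    have "x \<in> H" if "x \<in> V" for x
    proof -
      have "\<one> \<otimes> x \<otimes> inv \<one> \<in> H"
        using that unfolding V_def by blast
      then show ?thesis
        using that by (simp add: V_def)
    qed
    then show ?thesis
      using \<open>H \<subseteq> C\<close> C(3) by blast
  qed
  ultimately show thesis
    using that by blast
qed

end

section \<open>Open normal subgroups of p-power index\<close>

lemma (in group) subgroup_nat_pow_closed:
  assumes H: "subgroup H G" and x: "x \<in> H" shows "x [^] (n::nat) \<in> H"
proof (induction n)
  case (Suc n)
  then show ?case
    using subgroup.m_closed[OF H _ x] by simp
qed (simp add: subgroup.one_closed[OF H])

lemma (in group) nat_pow_conjugate:
  assumes g: "g \<in> carrier G" and x: "x \<in> carrier G"
  shows "(g \<otimes> x \<otimes> inv g) [^] (n::nat) = g \<otimes> x [^] n \<otimes> inv g"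
proof (induction n)
  case (Suc n)
  have "inv g \<otimes> (g \<otimes> (x \<otimes> inv g)) = x \<otimes> inv g"
    using g x by (simp add: m_assoc[symmetric])
  then show ?case
    using g x unfolding nat_pow_Suc Suc by (simp add: m_assoc)
qed (use g in simp)

lemma (in group_hom) normal_preimage:
  assumes "N \<lhd> H" shows "{g \<in> carrier G. h g \<in> N} \<lhd> G"
proof -
  interpret N: normal N H by fact
  show ?thesis
  proof (rule G.normal_invI)
    show "subgroup {g \<in> carrier G. h g \<in> N} G"
      by (rule G.subgroupI) (auto intro!: exI[of _ \<one>])
  qed (auto intro: N.inv_op_closed2)
qed

text \<open>The p-power index is expressed through powers of elements; for prime p and a profinite
  group this is the same by \<open>open_p_normal_iff_index\<close>.\<close>

definition open_p_normal :: "nat \<Rightarrow> ('a, 'b) monoid_scheme \<Rightarrow> 'a topology \<Rightarrow> 'a set \<Rightarrow> bool" where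
  "open_p_normal p G T N \<longleftrightarrow>
     N \<lhd> G \<and> openin T N \<and> (\<forall>x\<in>carrier G. \<exists>k. x [^]\<^bsub>G\<^esub> (p ^ k) \<in> N)"

context profinite_group
begin

lemma open_p_normal_iff_index:
  assumes "prime p"
  shows "open_p_normal p G T N \<longleftrightarrow> N \<lhd> G \<and> openin T N \<and> (\<exists>k. card (rcosets N) = p ^ k)"
proof (cases "N \<lhd> G \<and> openin T N")
  case True
  then have "finite (rcosets N)"
    using finite_rcosets_open_subgroup normal_imp_subgroup by metis
  then show ?thesis
    using True normal.rcosets_index_prime_power_iff[OF _ assms, of N G]
    unfolding open_p_normal_def by metis
qed (auto simp: open_p_normal_def)

lemma open_p_normal_carrier: "open_p_normal p G T (carrier G)"
proof -
  have "carrier G \<lhd> G"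
    by (rule normal_invI) (auto intro: subgroup_self)
  then show ?thesis
    using openin_topspace[of T] by (simp add: open_p_normal_def topspace_eq_carrier)
qed

lemma open_p_normal_Int:
  assumes M: "open_p_normal p G T M" and N: "open_p_normal p G T N"
  shows "open_p_normal p G T (M \<inter> N)"
proof -
  have sub: "subgroup M G" "subgroup N G"
    using assms normal_imp_subgroup by (auto simp: open_p_normal_def)
  have "\<exists>k. x [^] (p ^ k) \<in> M \<inter> N" if x: "x \<in> carrier G" for x
  proof -
    obtain k l where kl: "x [^] (p ^ k) \<in> M" "x [^] (p ^ l) \<in> N"
      using M N x unfolding open_p_normal_def by blast
    \<comment> \<open>The sum k + l serves both subgroups: this power of x is a power of each of the
      two given ones.\<close>
    have "x [^] (p ^ (k + l)) = (x [^] (p ^ k)) [^] (p ^ l)"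
      "x [^] (p ^ (k + l)) = (x [^] (p ^ l)) [^] (p ^ k)"
      using x by (simp_all add: nat_pow_pow power_add mult.commute)
    then have "x [^] (p ^ (k + l)) \<in> M \<inter> N"
      using kl sub subgroup_nat_pow_closed by (metis IntI)
    then show ?thesis by blast
  qed
  then show ?thesis
    using assms unfolding open_p_normal_def by (auto intro: normal_subgroup_intersect)
qed

text \<open>Cosets of an open subgroup are open, so the quotient topology is discrete, and the
  quotient is a finite group of order p^k. By Lagrange all its indices divide p^k.\<close>

lemma quotient_pro_p_group:
  assumes "prime p" and N: "open_p_normal p G T N"
  shows "pro_p_group (G Mod N) (quotient_topology T (\<lambda>g. N #> g)) p"
proof -
  interpret N: normal N G
    using N by (simp add: open_p_normal_def)
  have N_sub: "subgroup N G" and N_open: "openin T N"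
    using N N.subgroup_axioms by (simp_all add: open_p_normal_def)
  obtain k where k: "card (rcosets N) = p ^ k"
    using N open_p_normal_iff_index[OF assms(1)] by blast
  have fin: "finite (rcosets N)"
    using N_sub N_open by (rule finite_rcosets_open_subgroup)
  have carr: "carrier (G Mod N) = rcosets N"
    by (simp add: FactGroup_def)
  let ?S = "discrete_topology (rcosets N)"
  have "openin T {x \<in> topspace T. N #> x \<in> S}" for S
  proof (subst openin_subopen, intro ballI exI conjI)
    fix x assume x: "x \<in> {x \<in> topspace T. N #> x \<in> S}"
    then have xG: "x \<in> carrier G"
      by (simp add: topspace_eq_carrier)
    show "openin T (N #> x)"
      using N_open xG by (rule openin_r_coset)
    show "x \<in> N #> x"
      using xG N_sub by (rule rcos_self)
    show "N #> x \<subseteq> {x \<in> topspace T. N #> x \<in> S}"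
      using x repr_independence[OF _ xG N_sub] r_coset_subset_G[OF N.subset xG]
      by (auto simp: topspace_eq_carrier)
  qed
  then have top: "quotient_topology T (\<lambda>g. N #> g) = ?S"
    by (auto simp: topology_eq openin_quotient_topology topspace_eq_carrier RCOSETS_def)
  interpret Q: group "G Mod N"
    by (rule N.factorgroup_is_group)
  have "pro_p_group (G Mod N) ?S p"
  proof (unfold_locales)
    show "topspace ?S = carrier (G Mod N)"
      by (simp add: carr)
    show "continuous_map (prod_topology ?S ?S) ?S (\<lambda>(x, y). x \<otimes>\<^bsub>G Mod N\<^esub> y)"
      using Q.m_closed by (auto simp: carr simp flip: prod_topology_discrete_topology)
    show "continuous_map ?S ?S (\<lambda>x. inv\<^bsub>G Mod N\<^esub> x)"
      using Q.inv_closed by (auto simp: carr)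
    show "compact_space ?S"
      by (simp add: compact_space_discrete_topology fin)
    show "Hausdorff_space ?S"
      by (simp add: Hausdorff_space_discrete_topology)
    show "\<exists>a. C \<subseteq> {a}" if "connectedin ?S C" for C
      using that by (simp add: connectedin_discrete_topology)
    show "\<exists>k. card (rcosets\<^bsub>G Mod N\<^esub> U) = p ^ k" if U: "U \<lhd> G Mod N" for U
    proof -
      have "card (rcosets\<^bsub>G Mod N\<^esub> U) dvd p ^ k"
        using Q.lagrange[OF normal_imp_subgroup[OF U]] k by (metis carr dvd_triv_left order_def)
      then show ?thesis
        using assms(1) divides_primepow_nat by blast
    qed
  qed
  then show ?thesis
    by (simp add: top)
qed

text \<open>For the inclusion from right to left, let x lie outside a closed normal N with pro-p
  quotient. The Hausdorff quotient has an open normal subgroup missing the coset of x, and its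
  preimage is open, normal, of p-power index, and misses x.\<close>

lemma pro_p_kernel_eq_Inter:
  assumes "prime p"
  shows "pro_p_kernel p G T = \<Inter>{N. open_p_normal p G T N}"
proof (rule subset_antisym)
  show "pro_p_kernel p G T \<subseteq> \<Inter>{N. open_p_normal p G T N}"
    using quotient_pro_p_group[OF assms] closedin_open_subgroup normal_imp_subgroup
    unfolding pro_p_kernel_def open_p_normal_def by blast
  show "\<Inter>{N. open_p_normal p G T N} \<subseteq> pro_p_kernel p G T"
    unfolding pro_p_kernel_def
  proof (intro subsetI InterI, clarsimp)
    fix x N
    assume x: "\<forall>M. open_p_normal p G T M \<longrightarrow> x \<in> M"
      and N: "N \<lhd> G" "pro_p_group (G Mod N) (quotient_topology T (\<lambda>g. N #> g)) p"
    let ?Q = "G Mod N" and ?S = "quotient_topology T (\<lambda>g. N #> g)"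
    interpret N: normal N G by fact
    interpret Q: pro_p_group ?Q ?S p by fact
    interpret q: group_hom G ?Q "\<lambda>g. N #> g"
      by (intro group_hom.intro group_hom_axioms.intro N.r_coset_hom_Mod) unfold_locales
    have xG: "x \<in> carrier G"
      using x open_p_normal_carrier by blast
    show "x \<in> N"
    proof (rule ccontr)
      assume "x \<notin> N"
      then have "N #> x \<noteq> N"
        using xG N.subgroup_axioms coset_join1 by blast
      then have "\<one>\<^bsub>?Q\<^esub> \<in> topspace ?S - {N #> x}"
        using Q.one_closed Q.topspace_eq_carrier by auto
      moreover have "openin ?S (topspace ?S - {N #> x})"
        using closedin_Hausdorff_singleton[OF Q.Hausdorff] Q.topspace_eq_carrier q.hom_closed[OF xG]
        by (intro openin_diff openin_topspace) simp
      ultimately obtain V where V: "V \<lhd> ?Q" "openin ?S V" "V \<subseteq> topspace ?S - {N #> x}"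
        using Q.open_normal_subgroup_basis by blast
      let ?M = "{g \<in> carrier G. N #> g \<in> V}"
      have "\<exists>k. (N #> g) [^]\<^bsub>?Q\<^esub> (p ^ k) \<in> V" if "g \<in> carrier G" for g
      proof -
        have "open_p_normal p ?Q ?S V"
          using V Q.index_p_power[OF V(1,2)] Q.open_p_normal_iff_index[OF assms] by blast
        then show ?thesis
          using q.hom_closed[OF that] by (simp add: open_p_normal_def)
      qed
      then have "open_p_normal p G T ?M"
        using V(1,2) by (auto simp: open_p_normal_def q.normal_preimage openin_quotient_topology
          topspace_eq_carrier N.FactGroup_pow)
      then show False
        using x V(3) by blast
    qed
  qed
qed

lemma pro_p_kernel_normal:
  assumes "prime p" shows "pro_p_kernel p G T \<lhd> G"
proof -
  have sub: "subgroup N G" if "open_p_normal p G T N" for N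
    using that normal_imp_subgroup by (auto simp: open_p_normal_def)
  have "subgroup (\<Inter>{N. open_p_normal p G T N}) G"
    using sub open_p_normal_carrier by (intro subgroups_Inter) auto
  moreover have "x \<otimes> h \<otimes> inv x \<in> N"
    if "open_p_normal p G T N" "x \<in> carrier G" "h \<in> N" for x h N
    using that normal.inv_op_closed2 by (auto simp: open_p_normal_def)
  ultimately show ?thesis
    unfolding pro_p_kernel_eq_Inter[OF assms] by (intro normal_invI) auto
qed

text \<open>\<open>W\<close> and the complements of the open normal subgroups of p-power index cover
  the group. A finite subcover involves finitely many of these subgroups, and their intersection is
  again one of them.\<close>

lemma open_p_normal_in_neighbourhood:
  assumes "prime p" and W: "openin T W" "pro_p_kernel p G T \<subseteq> W"
  obtains M where "open_p_normal p G T M" "M \<subseteq> W"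
proof -
  let ?\<M> = "{N. open_p_normal p G T N}"
  let ?\<U> = "insert W ((\<lambda>M. topspace T - M) ` ?\<M>)"
  have clo: "openin T (topspace T - M)" if "M \<in> ?\<M>" for M
    using that closedin_open_subgroup normal_imp_subgroup by (auto simp: open_p_normal_def)
  have "\<forall>U\<in>?\<U>. openin T U"
    using W(1) clo by blast
  moreover have "\<Union>?\<U> = topspace T"
    using W openin_subset[OF W(1)] unfolding pro_p_kernel_eq_Inter[OF assms(1)] by auto
  ultimately obtain \<F> where F: "finite \<F>" "\<F> \<subseteq> ?\<U>" "\<Union>\<F> = topspace T"
    using compact unfolding compact_space by meson
  have "finite (\<F> - {W})" "\<F> - {W} \<subseteq> (\<lambda>M. topspace T - M) ` ?\<M>"
    using F by auto
  from finite_subset_image[OF this]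
  obtain \<N> where N: "finite \<N>" "\<N> \<subseteq> ?\<M>" "\<F> - {W} \<subseteq> (\<lambda>M. topspace T - M) ` \<N>"
    by auto
  from N(1,2) have "\<exists>M. open_p_normal p G T M \<and> M \<subseteq> \<Inter>\<N>"
  proof (induction \<N>)
    case empty
    then show ?case using open_p_normal_carrier by auto
  next
    case (insert N \<N>)
    then obtain M where "open_p_normal p G T M" "M \<subseteq> \<Inter>\<N>"
      by blast
    with insert.prems show ?case
      by (intro exI[of _ "N \<inter> M"]) (auto intro: open_p_normal_Int)
  qed
  then obtain M where M: "open_p_normal p G T M" "M \<subseteq> \<Inter>\<N>"
    by blast
  have "M \<subseteq> W"
  proof
    fix x assume x: "x \<in> M"
    then have "x \<in> \<Union>\<F>"
      using M(1) F(3) openin_subset[of T M] by (auto simp: open_p_normal_def)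
    then show "x \<in> W"
      using x M(2) N(3) by blast
  qed
  with M(1) show thesis
    by (rule that)
qed

text \<open>
  The maximal pro-\<open>p\<close> quotient of the kernel is trivial: otherwise intersecting the conjugates of
  \<open>A\<close> would produce a pro-\<open>p\<close> quotient of \<open>G\<close> larger than the maximal one.
\<close>

lemma pro_p_kernel_subset:
  assumes "prime p" and A: "subgroup A G" and W: "openin T W" "\<one> \<in> W"
    and KW: "pro_p_kernel p G T \<inter> W \<subseteq> A"
    and pow: "\<And>x. x \<in> pro_p_kernel p G T \<Longrightarrow> x [^] p \<in> A"
  shows "pro_p_kernel p G T \<subseteq> A"
proof -
  define K where "K = pro_p_kernel p G T"
  interpret K: normal K G
    unfolding K_def using assms(1) by (rule pro_p_kernel_normal)
  obtain V where V: "V \<lhd> G" "openin T V" "V \<subseteq> W"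
    using open_normal_subgroup_basis W by blast
  interpret V: normal V G by fact
  define D where "D = {k \<in> K. \<forall>g\<in>carrier G. g \<otimes> k \<otimes> inv g \<in> A}"
  have "D \<lhd> G"
  proof (rule normal_invI)
    show "subgroup D G"
    proof (rule subgroupI)
      show "D \<subseteq> carrier G"
        using K.subset by (auto simp: D_def)
      have "\<one> \<in> D"
        using subgroup.one_closed[OF A] by (simp add: D_def)
      then show "D \<noteq> {}"
        by blast
      show "inv x \<in> D" if x: "x \<in> D" for x
      proof -
        have "g \<otimes> inv x \<otimes> inv g = inv (g \<otimes> x \<otimes> inv g)" if "g \<in> carrier G" for g
          using x that by (simp add: D_def inv_mult_group m_assoc)
        then show ?thesis
          using x subgroup.m_inv_closed[OF A] by (simp add: D_def)
      qed
      show "x \<otimes> y \<in> D" if xy: "x \<in> D" "y \<in> D" for x y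
      proof -
        have "g \<otimes> (x \<otimes> y) \<otimes> inv g = (g \<otimes> x \<otimes> inv g) \<otimes> (g \<otimes> y \<otimes> inv g)"
          if "g \<in> carrier G" for g
        proof -
          have "inv g \<otimes> (g \<otimes> (y \<otimes> inv g)) = y \<otimes> inv g"
            using xy that by (simp add: D_def m_assoc[symmetric])
          then show ?thesis
            using xy that by (simp add: D_def m_assoc)
        qed
        then show ?thesis
          using xy subgroup.m_closed[OF A] by (simp add: D_def)
      qed
    qed
    show "x \<otimes> h \<otimes> inv x \<in> D" if "x \<in> carrier G" "h \<in> D" for x h
    proof -
      have "g \<otimes> (x \<otimes> h \<otimes> inv x) \<otimes> inv g = (g \<otimes> x) \<otimes> h \<otimes> inv (g \<otimes> x)" if "g \<in> carrier G" for g
        using \<open>x \<in> carrier G\<close> \<open>h \<in> D\<close> that by (simp add: D_def inv_mult_group m_assoc)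
      then show ?thesis
        using that by (auto simp: D_def intro: K.inv_op_closed2)
    qed
  qed
  then interpret D: normal D G .
  \<comment> \<open>\<open>K\<close> and \<open>D\<close> need not be open. Multiplying them by the
    open normal \<open>V\<close> gives open normal subgroups, to which the description of the kernel
    by open subgroups applies.\<close>
  have open_mult: "openin T (V <#> H)" if "subgroup H G" "V <#> H \<lhd> G" for H
  proof (rule openin_subgroup)
    show "subgroup (V <#> H) G"
      using that(2) by (rule normal_imp_subgroup)
    show "V \<subseteq> V <#> H"
    proof
      fix x assume "x \<in> V"
      moreover from this have "x = x \<otimes> \<one>"
        by simp
      ultimately show "x \<in> V <#> H"
        using subgroup.one_closed[OF that(1)] unfolding set_mult_def by blast
    qed
  qed (use V(2) V.one_closed in auto)
  have nVK: "V <#> K \<lhd> G" and nVD: "V <#> D \<lhd> G"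
    using V(1) K.normal_axioms D.normal_axioms by (simp_all add: normal_subgroup_set_mult_closed)
  have "K \<subseteq> V <#> K"
  proof
    fix x assume "x \<in> K"
    moreover from this have "x = \<one> \<otimes> x"
      by simp
    ultimately show "x \<in> V <#> K"
      using V.one_closed unfolding set_mult_def by blast
  qed
  then obtain M where M: "open_p_normal p G T M" "M \<subseteq> V <#> K"
    using open_p_normal_in_neighbourhood[OF assms(1) open_mult[OF K.subgroup_axioms nVK]]
    unfolding K_def by blast
  \<comment> \<open>One more p-th power leads from \<open>V <#> K\<close> to \<open>V <#> D\<close>:
    modulo \<open>V\<close> the given power of x is some y in \<open>K\<close>, and every conjugate
    of y^p is the p-th power of an element of \<open>K\<close>, hence lies in
    \<open>A\<close>.\<close>
  have "\<exists>k. x [^] (p ^ k) \<in> V <#> D" if x: "x \<in> carrier G" for x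
  proof -
    obtain k where "x [^] (p ^ k) \<in> V <#> K"
      using M x unfolding open_p_normal_def by blast
    then obtain v y where vy: "x [^] (p ^ k) = v \<otimes> y" "v \<in> V" "y \<in> K"
      by (auto simp: set_mult_def)
    have y: "y \<in> carrier G" and v: "v \<in> carrier G"
      using vy by auto
    have "g \<otimes> y [^] p \<otimes> inv g \<in> A" if g: "g \<in> carrier G" for g
      using pow[of "g \<otimes> y \<otimes> inv g"] K.inv_op_closed2[OF g vy(3)] nat_pow_conjugate[OF g y, of p]
      unfolding K_def by metis
    moreover have "y [^] p \<in> K"
      by (rule subgroup_nat_pow_closed[OF K.subgroup_axioms vy(3)])
    ultimately have "y [^] p \<in> D"
      unfolding D_def by blast
    have "V #> (v \<otimes> y) = V #> y"
      using coset_mult_assoc[OF V.subset v y] coset_join2[OF v V.subgroup_axioms vy(2)] by simp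
    then have "V #> (v \<otimes> y) [^] p = V #> y [^] p"
      using V.FactGroup_pow[OF y, of p] V.FactGroup_pow[OF m_closed[OF v y], of p] by simp
    then have "(v \<otimes> y) [^] p \<in> V #> y [^] p"
      using rcos_self[OF nat_pow_closed[OF m_closed[OF v y]] V.subgroup_axioms, of p] by simp
    then have "(v \<otimes> y) [^] p \<in> V <#> D"
      using \<open>y [^] p \<in> D\<close> by (auto simp: r_coset_def set_mult_def)
    moreover have "x [^] (p ^ Suc k) = (v \<otimes> y) [^] p"
      using vy(1) nat_pow_pow[OF x, of "p ^ k" p] by (simp add: mult.commute)
    ultimately have "x [^] (p ^ Suc k) \<in> V <#> D"
      by simp
    then show ?thesis ..
  qed
  then have "open_p_normal p G T (V <#> D)"
    using nVD open_mult D.subgroup_axioms by (auto simp: open_p_normal_def)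
  then have KVD: "K \<subseteq> V <#> D"
    unfolding K_def pro_p_kernel_eq_Inter[OF assms(1)] by blast
  have "D \<subseteq> A"
  proof
    fix x assume "x \<in> D"
    then have "\<one> \<otimes> x \<otimes> inv \<one> \<in> A" "x \<in> carrier G"
      unfolding D_def by (blast, simp)
    then show "x \<in> A"
      by simp
  qed
  \<comment> \<open>The enlargement by \<open>V\<close> is undone here: the factor v lies in
    \<open>K\<close> as well as in \<open>V\<close>, and \<open>K\<close> meets \<open>V\<close>
    only inside \<open>A\<close> because \<open>V\<close> was chosen within
    \<open>W\<close>.\<close>
  have "x \<in> A" if x: "x \<in> K" for x
  proof -
    obtain v d where vd: "x = v \<otimes> d" "v \<in> V" "d \<in> D"
      using KVD x by (auto simp: set_mult_def)
    then have v: "v = x \<otimes> inv d"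
      by (simp add: m_assoc)
    have "d \<in> K"
      using vd(3) unfolding D_def by blast
    then have "v \<in> K"
      unfolding v using x K.m_closed K.m_inv_closed by blast
    then have "v \<in> A"
      using KW V(3) vd(2) K_def by blast
    then show ?thesis
      using vd subgroup.m_closed[OF A] \<open>D \<subseteq> A\<close> by blast
  qed
  then show ?thesis
    by (auto simp: K_def)
qed

end

section \<open>Cochains of low degree\<close>

text \<open>Homogeneous n-cochains take n + 1 entries, so pairs are the arguments in degree one and
  triples those in degree two. The restriction to the index set matches the extensional
  \<open>tuples\<close>.\<close>

definition tuple2 :: "'a \<Rightarrow> 'a \<Rightarrow> nat \<Rightarrow> 'a" where
  "tuple2 a b = (\<lambda>i\<in>{..Suc 0}. if i = 0 then a else b)"

definition tuple3 :: "'a \<Rightarrow> 'a \<Rightarrow> 'a \<Rightarrow> nat \<Rightarrow> 'a" where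
  "tuple3 a b c = (\<lambda>i\<in>{..Suc (Suc 0)}. if i = 0 then a else if i = Suc 0 then b else c)"

lemma tuple2_in_tuples [simp]: "tuple2 a b \<in> tuples (Suc 0) S \<longleftrightarrow> a \<in> S \<and> b \<in> S"
  by (auto simp: tuple2_def tuples_def PiE_iff atMost_Suc)

lemma tuple3_in_tuples [simp]: "tuple3 a b c \<in> tuples (Suc (Suc 0)) S \<longleftrightarrow> a \<in> S \<and> b \<in> S \<and> c \<in> S"
  by (auto simp: tuple3_def tuples_def PiE_iff atMost_Suc)

lemma tuples_Suc_0_cases:
  assumes "x \<in> tuples (Suc 0) S"
  obtains a b where "x = tuple2 a b" "a \<in> S" "b \<in> S"
proof
  show "x = tuple2 (x 0) (x (Suc 0))"
    using assms by (auto simp: tuple2_def tuples_def PiE_iff extensional_def restrict_def fun_eq_iff le_Suc_eq)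
qed (use assms in \<open>auto simp: tuples_def\<close>)

lemma face_tuple2 [simp]:
  "face 0 0 (tuple2 a b) = (\<lambda>i\<in>{..0}. b)" "face 0 (Suc 0) (tuple2 a b) = (\<lambda>i\<in>{..0}. a)"
  by (auto simp: face_def tuple2_def fun_eq_iff)

lemma face_tuple3 [simp]:
  "face (Suc 0) 0 (tuple3 a b c) = tuple2 b c"
  "face (Suc 0) (Suc 0) (tuple3 a b c) = tuple2 a c"
  "face (Suc 0) (Suc (Suc 0)) (tuple3 a b c) = tuple2 a b"
  by (auto simp: face_def tuple2_def tuple3_def fun_eq_iff)

lemma face_in_tuples: "x \<in> tuples (Suc n) S \<Longrightarrow> face n i x \<in> tuples n S"
  by (auto simp: face_def tuples_def)

lemma translate_tuple2 [simp]:
  "translate G (Suc 0) g (tuple2 a b) = tuple2 (g \<otimes>\<^bsub>G\<^esub> a) (g \<otimes>\<^bsub>G\<^esub> b)"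
  by (auto simp: translate_def tuple2_def fun_eq_iff)

section \<open>Cocycles, coboundaries and classes in low degree\<close>

locale cochain_setting = cring R + G: group G
  for R :: "('r, 'm) ring_scheme" (structure) and G :: "('a, 'b) monoid_scheme" and T :: "'a topology" +
  assumes topspace_eq: "topspace T = carrier G"
begin

abbreviation X :: "nat \<Rightarrow> (nat \<Rightarrow> 'a) set" where
  "X n \<equiv> tuples n (carrier G)"

lemma topspace_product_tuples: "topspace (product_topology (\<lambda>_. T) {..n}) = X n"
  by (simp add: tuples_def topspace_eq)

lemma translate_in_tuples: "g \<in> carrier G \<Longrightarrow> x \<in> X n \<Longrightarrow> translate G n g x \<in> X n"
  by (auto simp: translate_def tuples_def)

lemma cochains_PiE: "f \<in> cochains R n G T U \<Longrightarrow> f \<in> X n \<rightarrow>\<^sub>E carrier R"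
  by (simp add: cochains_def)

lemma cochains_closed: "f \<in> cochains R n G T U \<Longrightarrow> x \<in> X n \<Longrightarrow> f x \<in> carrier R"
  by (auto simp: cochains_def)

lemma cochains_translate:
  "f \<in> cochains R n G T U \<Longrightarrow> u \<in> U \<Longrightarrow> x \<in> X n \<Longrightarrow> f (translate G n u x) = f x"
  by (simp add: cochains_def)

lemma differential_tuple3:
  assumes f: "\<And>x. x \<in> X (Suc 0) \<Longrightarrow> f x \<in> carrier R"
    and abc: "a \<in> carrier G" "b \<in> carrier G" "c \<in> carrier G"
  shows "differential R (Suc 0) G f (tuple3 a b c)
    = f (tuple2 a b) \<oplus> (\<ominus> f (tuple2 a c) \<oplus> f (tuple2 b c))"
proof -
  let ?s = "\<lambda>i. if even i then f (face (Suc 0) i (tuple3 a b c)) else \<ominus> f (face (Suc 0) i (tuple3 a b c))"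
  have s: "?s \<in> {..n} \<rightarrow> carrier R" for n
    using abc f face_in_tuples[of "tuple3 a b c" "Suc 0" "carrier G"] by auto
  have s0: "finsum R ?s {..0} = ?s 0"
    using s[of 0] by (intro finsum_0) simp
  have "finsum R ?s {..Suc (Suc 0)} = ?s (Suc (Suc 0)) \<oplus> (?s (Suc 0) \<oplus> ?s 0)"
    by (simp only: finsum_Suc[OF s] s0)
  then show ?thesis
    using abc by (simp add: differential_def)
qed

lemma differential_tuple2:
  assumes f: "\<And>x. x \<in> X 0 \<Longrightarrow> f x \<in> carrier R" and ab: "a \<in> carrier G" "b \<in> carrier G"
  shows "differential R 0 G f (tuple2 a b) = \<ominus> f (\<lambda>i\<in>{..0}. a) \<oplus> f (\<lambda>i\<in>{..0}. b)"
proof -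
  let ?s = "\<lambda>i. if even i then f (face 0 i (tuple2 a b)) else \<ominus> f (face 0 i (tuple2 a b))"
  have s: "?s \<in> {..n} \<rightarrow> carrier R" for n
    using ab f face_in_tuples[of "tuple2 a b" 0 "carrier G"] by auto
  have s0: "finsum R ?s {..0} = ?s 0"
    using s[of 0] by (intro finsum_0) simp
  have "finsum R ?s {..Suc 0} = ?s (Suc 0) \<oplus> ?s 0"
    by (simp only: finsum_Suc[OF s] s0)
  then show ?thesis
    using ab by (simp add: differential_def)
qed

lemma add_neg_cancel_iff:
  assumes "x \<in> carrier R" "y \<in> carrier R" "z \<in> carrier R"
  shows "x \<oplus> (\<ominus> y \<oplus> z) = \<zero> \<longleftrightarrow> x \<oplus> z = y"
proof -
  have "x \<oplus> (\<ominus> y \<oplus> z) = (x \<oplus> z) \<ominus> y"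
    using assms by algebra
  then show ?thesis
    using assms by simp
qed

lemma cocycle_add:
  assumes f: "f \<in> cocycles R (Suc 0) G T U"
    and abc: "a \<in> carrier G" "b \<in> carrier G" "c \<in> carrier G"
  shows "f (tuple2 a b) \<oplus> f (tuple2 b c) = f (tuple2 a c)"
proof -
  have fc: "f \<in> cochains R (Suc 0) G T U"
    and "differential R (Suc 0) G f (tuple3 a b c) = zero_cochain R (Suc (Suc 0)) G (tuple3 a b c)"
    using f by (simp_all add: cocycles_def)
  then have "f (tuple2 a b) \<oplus> (\<ominus> f (tuple2 a c) \<oplus> f (tuple2 b c)) = \<zero>"
    using abc cochains_closed[OF fc] by (simp add: differential_tuple3 zero_cochain_def)
  then show ?thesis
    using abc cochains_closed[OF fc] by (simp add: add_neg_cancel_iff)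
qed

lemma cocycle_diagonal:
  assumes f: "f \<in> cocycles R (Suc 0) G T U" and a: "a \<in> carrier G"
  shows "f (tuple2 a a) = \<zero>"
proof -
  have "f (tuple2 a a) \<in> carrier R"
    using f a by (intro cochains_closed) (auto simp: cocycles_def)
  with cocycle_add[OF f a a a] show ?thesis
    using add.l_cancel_one by blast
qed

lemma zero_cochain_in_cochains: "U \<subseteq> carrier G \<Longrightarrow> zero_cochain R n G \<in> cochains R n G T U"
  unfolding cochains_def zero_cochain_def
  by (auto simp: translate_in_tuples subset_iff intro!: continuous_map_eq[of _ _ "\<lambda>x. \<zero>"]
      simp: topspace_product_tuples simp del: topspace_product_topology)

text \<open>Any operation on discrete spaces is continuous, so \<open>m\<close> may be arbitrary. It
  is used for addition and, ignoring the second argument, for negation.\<close>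

lemma cochains_map2:
  assumes f: "f \<in> cochains R n G T U" and g: "g \<in> cochains R n G T U" and U: "U \<subseteq> carrier G"
    and m: "\<And>x y. x \<in> carrier R \<Longrightarrow> y \<in> carrier R \<Longrightarrow> m x y \<in> carrier R"
  shows "(\<lambda>x\<in>X n. m (f x) (g x)) \<in> cochains R n G T U"
proof -
  let ?P = "product_topology (\<lambda>_. T) {..n}" and ?D = "discrete_topology (carrier R)"
  have "continuous_map ?P (prod_topology ?D ?D) (\<lambda>x. (f x, g x))"
    using f g by (intro continuous_map_pairedI) (auto simp: cochains_def)
  moreover have "continuous_map (prod_topology ?D ?D) ?D (\<lambda>(x, y). m x y)"
    using m by (auto simp flip: prod_topology_discrete_topology)
  ultimately have "continuous_map ?P ?D ((\<lambda>(x, y). m x y) \<circ> (\<lambda>x. (f x, g x)))"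
    by (rule continuous_map_compose)
  then have "continuous_map ?P ?D (\<lambda>x\<in>X n. m (f x) (g x))"
    by (rule continuous_map_eq) (simp add: topspace_product_tuples del: topspace_product_topology)
  moreover have "translate G n u x \<in> X n" if "u \<in> U" "x \<in> X n" for u x
    using that U translate_in_tuples by blast
  ultimately show ?thesis
    using f g m cochains_closed[OF f] cochains_closed[OF g] by (auto simp: cochains_def)
qed

lemma differential_add:
  assumes f: "\<And>x. x \<in> X n \<Longrightarrow> f x \<in> carrier R" and g: "\<And>x. x \<in> X n \<Longrightarrow> g x \<in> carrier R"
  shows "differential R n G (\<lambda>x\<in>X n. f x \<oplus> g x) =
    (\<lambda>x\<in>X (Suc n). differential R n G f x \<oplus> differential R n G g x)"
proof
  fix x
  show "differential R n G (\<lambda>x\<in>X n. f x \<oplus> g x) x =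
    (\<lambda>x\<in>X (Suc n). differential R n G f x \<oplus> differential R n G g x) x"
  proof (cases "x \<in> X (Suc n)")
    case True
    have F: "face n i x \<in> X n" for i
      using True by (rule face_in_tuples)
    let ?s = "\<lambda>f i. if even i then f (face n i x) else \<ominus> f (face n i x)"
    have s: "?s f \<in> {..Suc n} \<rightarrow> carrier R" "?s g \<in> {..Suc n} \<rightarrow> carrier R"
      using F f g by auto
    have "finsum R (?s (\<lambda>x\<in>X n. f x \<oplus> g x)) {..Suc n} = finsum R (\<lambda>i. ?s f i \<oplus> ?s g i) {..Suc n}"
      using F f g by (intro finsum_cong') (auto simp: minus_add)
    also have "\<dots> = finsum R (?s f) {..Suc n} \<oplus> finsum R (?s g) {..Suc n}"
      using s by (rule finsum_addf)
    finally show ?thesis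
      using True by (simp add: differential_def del: finsum_Suc)
  qed (simp add: differential_def)
qed

lemma differential_neg:
  assumes f: "\<And>x. x \<in> X n \<Longrightarrow> f x \<in> carrier R"
  shows "differential R n G (\<lambda>x\<in>X n. \<ominus> f x) = (\<lambda>x\<in>X (Suc n). \<ominus> differential R n G f x)"
proof
  fix x
  show "differential R n G (\<lambda>x\<in>X n. \<ominus> f x) x = (\<lambda>x\<in>X (Suc n). \<ominus> differential R n G f x) x"
  proof (cases "x \<in> X (Suc n)")
    case True
    have F: "face n i x \<in> X n" for i
      using True by (rule face_in_tuples)
    let ?s = "\<lambda>i. if even i then f (face n i x) else \<ominus> f (face n i x)"
    have s: "?s \<in> {..Suc n} \<rightarrow> carrier R"
      using F f by auto
    have "finsum R (\<lambda>i. \<ominus> ?s i) {..Suc n} \<oplus> finsum R ?s {..Suc n} = finsum R (\<lambda>i. \<ominus> ?s i \<oplus> ?s i) {..Suc n}"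
      using s by (intro finsum_addf[symmetric]) auto
    also have "\<dots> = \<zero>"
      using F f by (intro add.finprod_one_eqI) (auto simp: l_neg r_neg)
    finally have "finsum R (\<lambda>i. \<ominus> ?s i) {..Suc n} = \<ominus> finsum R ?s {..Suc n}"
    proof (rule minus_equality[symmetric])
      show "finsum R ?s {..Suc n} \<in> carrier R" "finsum R (\<lambda>i. \<ominus> ?s i) {..Suc n} \<in> carrier R"
        by (rule finsum_closed, use s in blast)+
    qed
    moreover have "finsum R (\<lambda>i. \<ominus> ?s i) {..Suc n} =
      finsum R (\<lambda>i. if even i then (\<lambda>x\<in>X n. \<ominus> f x) (face n i x) else \<ominus> (\<lambda>x\<in>X n. \<ominus> f x) (face n i x)) {..Suc n}"
      using F f by (intro finsum_cong') auto
    ultimately show ?thesis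
      using True by (simp add: differential_def del: finsum_Suc)
  qed (simp add: differential_def)
qed

text \<open>The group acts transitively on itself, so an invariant 0-cochain is constant and its
  differential is zero.\<close>

lemma coboundaries_Suc_0: "coboundaries R (Suc 0) G T (carrier G) = {zero_cochain R (Suc 0) G}"
proof -
  have "differential R 0 G h = zero_cochain R (Suc 0) G" if h: "h \<in> cochains R 0 G T (carrier G)" for h
  proof
    fix x
    have const: "h (\<lambda>i\<in>{..0}. a) = h (\<lambda>i\<in>{..0}. \<one>\<^bsub>G\<^esub>)" if a: "a \<in> carrier G" for a
    proof -
      have "translate G 0 a (\<lambda>i\<in>{..0}. \<one>\<^bsub>G\<^esub>) = (\<lambda>i\<in>{..0}. a)"
        using a by (auto simp: translate_def fun_eq_iff)
      then show ?thesis
        using cochains_translate[OF h a, of "\<lambda>i\<in>{..0}. \<one>\<^bsub>G\<^esub>"] by (simp add: tuples_def)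
    qed
    have const_closed: "h (\<lambda>i\<in>{..0}. \<one>\<^bsub>G\<^esub>) \<in> carrier R"
      by (rule cochains_closed[OF h]) (auto simp: tuples_def)
    show "differential R 0 G h x = zero_cochain R (Suc 0) G x"
    proof (cases "x \<in> X (Suc 0)")
      case True
      then obtain a b where ab: "x = tuple2 a b" "a \<in> carrier G" "b \<in> carrier G"
        by (rule tuples_Suc_0_cases)
      show ?thesis
        using differential_tuple2[of h a b] cochains_closed[OF h] const[OF ab(2)] const[OF ab(3)]
          const_closed ab by (simp add: l_neg zero_cochain_def)
    qed (simp add: differential_def zero_cochain_def)
  qed
  then show ?thesis
    using zero_cochain_in_cochains[of "carrier G" 0] by (auto simp: coboundaries_def)
qed

lemma cohomology_class_Suc_0:
  assumes "f \<in> X (Suc 0) \<rightarrow>\<^sub>E carrier R"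
  shows "cohomology_class R (Suc 0) G T f = {f}"
proof -
  have "(\<lambda>x\<in>X (Suc 0). zero_cochain R (Suc 0) G x \<oplus> f x) = f"
    using assms by (auto simp: zero_cochain_def fun_eq_iff PiE_iff extensional_def)
  then show ?thesis
    by (simp add: cohomology_class_def coboundaries_Suc_0 r_coset_def cocycle_group_def)
qed

lemma carrier_cohomology_Suc_0:
  "carrier (cohomology R (Suc 0) G T) = (\<lambda>f. {f}) ` cocycles R (Suc 0) G T (carrier G)"
proof -
  have "cohomology_class R (Suc 0) G T f = {f}" if "f \<in> cocycles R (Suc 0) G T (carrier G)" for f
    using that by (intro cohomology_class_Suc_0 cochains_PiE) (auto simp: cocycles_def)
  then show ?thesis
    by (auto simp: cohomology_def FactGroup_def RCOSETS_def cohomology_class_def cocycle_group_def)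
qed

text \<open>The usual criterion B + c = B for c in B, derived directly from additivity of the
  differential. As \<open>c\<close> is any R-valued cochain function, it applies to cup products
  before they are known to be cocycles.\<close>

lemma cohomology_class_eq_one_iff:
  assumes c: "c \<in> X (Suc n) \<rightarrow>\<^sub>E carrier R"
  shows "cohomology_class R (Suc n) G T c = \<one>\<^bsub>cohomology R (Suc n) G T\<^esub>
    \<longleftrightarrow> c \<in> coboundaries R (Suc n) G T (carrier G)"
proof -
  let ?C = "cochains R n G T (carrier G)" and ?B = "coboundaries R (Suc n) G T (carrier G)"
  let ?d = "differential R n G"
  have B: "?B = ?d ` ?C"
    by (simp add: coboundaries_def)
  have cls: "cohomology_class R (Suc n) G T c = (\<lambda>b. \<lambda>x\<in>X (Suc n). b x \<oplus> c x) ` ?B"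
    by (auto simp: cohomology_class_def r_coset_def cocycle_group_def)
  have d_closed: "?d h x \<in> carrier R" if "h \<in> ?C" "x \<in> X (Suc n)" for h x
    using that cochains_closed[OF that(1)] face_in_tuples[OF that(2)]
    by (auto simp: differential_def intro!: finsum_closed)
  have dadd: "?d (\<lambda>x\<in>X n. h x \<oplus> k x) = (\<lambda>x\<in>X (Suc n). ?d h x \<oplus> ?d k x)"
    if "h \<in> ?C" "k \<in> ?C" for h k
    using that by (intro differential_add) (auto intro: cochains_closed)
  have zero: "zero_cochain R (Suc n) G \<in> ?B"
  proof -
    have z: "zero_cochain R n G \<in> ?C"
      by (simp add: zero_cochain_in_cochains)
    have "?d (zero_cochain R n G) = zero_cochain R (Suc n) G"
    proof
      fix x show "?d (zero_cochain R n G) x = zero_cochain R (Suc n) G x"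
        by (cases "x \<in> X (Suc n)")
          (auto simp: differential_def zero_cochain_def face_in_tuples intro!: add.finprod_one_eqI)
    qed
    with z show ?thesis
      unfolding B by (metis imageI)
  qed
  have "(\<lambda>b. \<lambda>x\<in>X (Suc n). b x \<oplus> c x) ` ?B = ?B \<longleftrightarrow> c \<in> ?B"
  proof
    assume eq: "(\<lambda>b. \<lambda>x\<in>X (Suc n). b x \<oplus> c x) ` ?B = ?B"
    have "c = (\<lambda>x\<in>X (Suc n). zero_cochain R (Suc n) G x \<oplus> c x)"
      using c by (auto simp: zero_cochain_def fun_eq_iff PiE_iff extensional_def)
    then have "c \<in> (\<lambda>b. \<lambda>x\<in>X (Suc n). b x \<oplus> c x) ` ?B"
      using zero by (rule image_eqI)
    then show "c \<in> ?B"
      unfolding eq .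
  next
    assume "c \<in> ?B"
    then obtain k where k: "k \<in> ?C" "c = ?d k"
      unfolding B by blast
    have "(\<lambda>x\<in>X (Suc n). ?d h x \<oplus> c x) \<in> ?B" if "h \<in> ?C" for h
    proof -
      have "(\<lambda>x\<in>X n. h x \<oplus> k x) \<in> ?C"
        using cochains_map2[OF that k(1), of "(\<oplus>)"] by simp
      then show ?thesis
        unfolding B k(2) dadd[OF that k(1), symmetric] by (rule imageI)
    qed
    \<comment> \<open>Every coboundary dh is of the shifted form because c = dk: it equals d(h - k)
      + c, and \<open>k'\<close> is the cochain -k.\<close>
    moreover have "?d h \<in> (\<lambda>b. \<lambda>x\<in>X (Suc n). b x \<oplus> c x) ` ?B" if h: "h \<in> ?C" for h
    proof -
      define k' where "k' = (\<lambda>x\<in>X n. \<ominus> k x)"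
      have k': "k' \<in> ?C" "?d k' = (\<lambda>x\<in>X (Suc n). \<ominus> ?d k x)"
        using cochains_map2[OF k(1) k(1), of "\<lambda>x y. \<ominus> x"] differential_neg[of n k] cochains_closed[OF k(1)]
        by (simp_all add: k'_def)
      let ?h = "\<lambda>x\<in>X n. h x \<oplus> k' x"
      have "?h \<in> ?C"
        using cochains_map2[OF h k'(1), of "(\<oplus>)"] by simp
      moreover have "?d h = (\<lambda>x\<in>X (Suc n). ?d ?h x \<oplus> c x)"
      proof
        fix x show "?d h x = (\<lambda>x\<in>X (Suc n). ?d ?h x \<oplus> c x) x"
        proof (cases "x \<in> X (Suc n)")
          case True
          then show ?thesis
            using d_closed[OF h True] d_closed[OF k(1) True]
            by (simp add: dadd[OF h k'(1)] k' k(2) a_assoc l_neg)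
        qed (simp add: differential_def)
      qed
      ultimately show ?thesis
        by (intro image_eqI) (auto simp: B)
    qed
    ultimately show "(\<lambda>b. \<lambda>x\<in>X (Suc n). b x \<oplus> c x) ` ?B = ?B"
      unfolding B by (intro subset_antisym subsetI) (auto simp only: image_iff)
  qed
  then show ?thesis
    by (simp add: cls cohomology_def)
qed

lemma cup_cochain_closed:
  assumes "f \<in> X m \<rightarrow> carrier R" "g \<in> X n \<rightarrow> carrier R"
  shows "cup_cochain R m n G f g \<in> X (m + n) \<rightarrow>\<^sub>E carrier R"
proof -
  have "(\<lambda>i\<in>{..m}. x i) \<in> X m" "(\<lambda>i\<in>{..n}. x (m + i)) \<in> X n" if "x \<in> X (m + n)" for x
    using that by (auto simp: tuples_def)
  then show ?thesis
    using assms by (auto simp: cup_cochain_def Pi_iff)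
qed

lemma norm_cochain_closed:
  assumes "subgroup U G" and f: "f \<in> X n \<rightarrow> carrier R"
  shows "norm_cochain R n G U f \<in> X n \<rightarrow>\<^sub>E carrier R"
proof -
  have "translate G n (inv\<^bsub>G\<^esub> (SOME s. s \<in> S)) x \<in> X n" if S: "S \<in> lcosets\<^bsub>G\<^esub> U" and x: "x \<in> X n" for S x
  proof -
    obtain a where a: "a \<in> carrier G" "S = a <#\<^bsub>G\<^esub> U"
      using S by (auto simp: LCOSETS_def)
    have "(SOME s. s \<in> S) \<in> S"
      using G.lcos_self[OF a(1) assms(1)] unfolding a(2)[symmetric] by (rule someI)
    then have "(SOME s. s \<in> S) \<in> carrier G"
      using G.l_coset_carrier a assms(1) by blast
    then show ?thesis
      using x by (intro translate_in_tuples G.inv_closed)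
  qed
  then show ?thesis
    using f by (auto simp: norm_cochain_def Pi_iff intro!: finsum_closed)
qed

end

text \<open>The cocycles underlying \<open>cup_radical\<close>, over general coefficients. Inflation
  acts on cochains, so the comparison is made on this level.\<close>

definition radical_cocycles ::
    "('r, 'm) ring_scheme \<Rightarrow> ('a, 'b) monoid_scheme \<Rightarrow> 'a topology \<Rightarrow> ((nat \<Rightarrow> 'a) \<Rightarrow> 'r) set" where
  "radical_cocycles R G T =
     {f \<in> cocycles R (Suc 0) G T (carrier G). \<forall>g\<in>cocycles R (Suc 0) G T (carrier G).
        cup_cochain R (Suc 0) (Suc 0) G f g \<in> coboundaries R (Suc (Suc 0)) G T (carrier G)}"

text \<open>Degree-one classes are singletons, as all coboundaries in that degree vanish.\<close>

lemma cup_radical_eq: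
  assumes "cochain_setting (residue_ring (int p)) G T"
  shows "cup_radical p G T = (\<lambda>f. {f}) ` radical_cocycles (residue_ring (int p)) G T"
proof -
  interpret cochain_setting "residue_ring (int p)" G T
    by fact
  let ?R = "residue_ring (int p)"
  have "cup ?R (Suc 0) (Suc 0) G T {f} {g} = \<one>\<^bsub>cohomology ?R (Suc (Suc 0)) G T\<^esub>
      \<longleftrightarrow> cup_cochain ?R (Suc 0) (Suc 0) G f g \<in> coboundaries ?R (Suc (Suc 0)) G T (carrier G)"
    if "f \<in> cocycles ?R (Suc 0) G T (carrier G)" "g \<in> cocycles ?R (Suc 0) G T (carrier G)" for f g
  proof -
    have "cup_cochain ?R (Suc 0) (Suc 0) G f g \<in> X (Suc (Suc 0)) \<rightarrow>\<^sub>E carrier ?R"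
      using cup_cochain_closed[of f "Suc 0" g "Suc 0"] that
      by (auto simp: cocycles_def cochains_closed)
    then show ?thesis
      using cohomology_class_eq_one_iff by (simp add: cup_def)
  qed
  then show ?thesis
    unfolding cup_radical_def radical_cocycles_def One_nat_def numeral_2_eq_2 carrier_cohomology_Suc_0
    by auto
qed

section \<open>Inflation along an open quotient map\<close>

definition map_tuple :: "('a \<Rightarrow> 'c) \<Rightarrow> nat \<Rightarrow> (nat \<Rightarrow> 'a) \<Rightarrow> nat \<Rightarrow> 'c" where
  "map_tuple q n x = (\<lambda>i\<in>{..n}. q (x i))"

definition inflation ::
    "('a, 'b) monoid_scheme \<Rightarrow> ('a \<Rightarrow> 'c) \<Rightarrow> nat \<Rightarrow> ((nat \<Rightarrow> 'c) \<Rightarrow> 'r) \<Rightarrow> (nat \<Rightarrow> 'a) \<Rightarrow> 'r" where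
  "inflation G q n f = (\<lambda>x\<in>tuples n (carrier G). f (map_tuple q n x))"

lemma map_tuple_image: "map_tuple q n ` tuples n A = tuples n (q ` A)"
proof (intro equalityI subsetI)
  fix y assume y: "y \<in> tuples n (q ` A)"
  let ?x = "\<lambda>i\<in>{..n}. inv_into A q (y i)"
  have "?x \<in> tuples n A"
    using y by (auto simp: tuples_def PiE_iff intro: inv_into_into)
  moreover have "y = map_tuple q n ?x"
    using y by (auto simp: tuples_def map_tuple_def PiE_iff extensional_def f_inv_into_f fun_eq_iff)
  ultimately show "y \<in> map_tuple q n ` tuples n A"
    by blast
qed (auto simp: map_tuple_def tuples_def)

lemma map_tuple_in_tuples: "x \<in> tuples n A \<Longrightarrow> map_tuple q n x \<in> tuples n (q ` A)"
  using map_tuple_image by blast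

lemma map_tuple_tuple2 [simp]: "map_tuple q (Suc 0) (tuple2 a b) = tuple2 (q a) (q b)"
  by (auto simp: map_tuple_def tuple2_def fun_eq_iff)

lemma face_map_tuple: "face n i (map_tuple q (Suc n) x) = map_tuple q n (face n i x)"
  by (auto simp: face_def map_tuple_def fun_eq_iff)

text \<open>The assumption \<open>hom_kernel_trivial\<close> expresses H^1(K, R) = 0. It speaks of
  maps that are continuous on the whole group and additive on the kernel, since it is applied to x
  -> F(xa, a) for a cochain F; \<open>continuous_translation\<close> makes this map
  continuous.\<close>

locale inflation_setting = G: cochain_setting R G T + Q: cochain_setting R Q S
  for R :: "('r, 'm) ring_scheme" (structure)
    and G :: "('a, 'b) monoid_scheme" and T :: "'a topology"
    and Q :: "('c, 'd) monoid_scheme" and S :: "'c topology" +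
  fixes q :: "'a \<Rightarrow> 'c"
  assumes q_hom: "q \<in> hom G Q" and q_surj: "q ` carrier G = carrier Q"
    and q_continuous: "continuous_map T S q" and q_open: "open_map T S q"
    and continuous_translation: "\<And>g. g \<in> carrier G \<Longrightarrow> continuous_map T T (\<lambda>x. x \<otimes>\<^bsub>G\<^esub> g)"
    and hom_kernel_trivial:
      "\<And>h k. continuous_map T (discrete_topology (carrier R)) h \<Longrightarrow>
        (\<And>x y. x \<in> kernel G Q q \<Longrightarrow> y \<in> kernel G Q q \<Longrightarrow> h (x \<otimes>\<^bsub>G\<^esub> y) = h x \<oplus> h y) \<Longrightarrow>
        k \<in> kernel G Q q \<Longrightarrow> h k = \<zero>"
begin

sublocale q: group_hom G Q q
  using q_hom by (simp add: group_hom_def group_hom_axioms_def G.G.is_group Q.G.is_group)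

abbreviation K :: "'a set" where
  "K \<equiv> kernel G Q q"

abbreviation I :: "nat \<Rightarrow> ((nat \<Rightarrow> 'c) \<Rightarrow> 'r) \<Rightarrow> (nat \<Rightarrow> 'a) \<Rightarrow> 'r" where
  "I \<equiv> inflation G q"

lemma map_tuple_X [simp]: "x \<in> G.X n \<Longrightarrow> map_tuple q n x \<in> Q.X n"
  using map_tuple_in_tuples[of x n "carrier G" q] by (simp add: q_surj)

lemma inflation_apply: "x \<in> G.X n \<Longrightarrow> I n f x = f (map_tuple q n x)"
  by (simp add: inflation_def)

lemma X_eq_image: "Q.X n = map_tuple q n ` G.X n"
  by (simp add: map_tuple_image q_surj)

lemma X_cases:
  assumes "y \<in> Q.X n" obtains x where "x \<in> G.X n" "y = map_tuple q n x"
  using assms that by (auto simp: X_eq_image)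

lemma inj_on_inflation: "inj_on (I n) (extensional (Q.X n))"
proof (rule inj_onI)
  fix f g assume fg: "f \<in> extensional (Q.X n)" "g \<in> extensional (Q.X n)" "I n f = I n g"
  have "f y = g y" if "y \<in> Q.X n" for y
    using that fun_cong[OF fg(3)] by (auto elim!: X_cases simp: inflation_def) (metis restrict_apply')
  then show "f = g"
    using fg by (meson extensionalityI)
qed

text \<open>A product of quotient maps need not be a quotient map, but a finite product of open
  surjections is an open surjection. This is where openness of \<open>q\<close> enters.\<close>

lemma quotient_map_map_tuple:
  "quotient_map (product_topology (\<lambda>_. T) {..n}) (product_topology (\<lambda>_. S) {..n}) (map_tuple q n)"
proof (rule continuous_open_imp_quotient_map)
  let ?P = "product_topology (\<lambda>_. T) {..n}" and ?P' = "product_topology (\<lambda>_. S) {..n}"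
  have "continuous_map ?P S (\<lambda>x. q (x i))" if "i \<le> n" for i
    using continuous_map_compose[OF continuous_map_product_projection[of i "{..n}" "\<lambda>_. T"] q_continuous] that
    by (simp add: o_def)
  then have "continuous_map ?P S (\<lambda>x. map_tuple q n x i)" if "i \<le> n" for i
    using that by (simp add: map_tuple_def)
  then show "continuous_map ?P ?P' (map_tuple q n)"
    by (auto simp: continuous_map_componentwise map_tuple_def)
  show "map_tuple q n ` topspace ?P = topspace ?P'"
    by (simp only: G.topspace_product_tuples Q.topspace_product_tuples map_tuple_image q_surj)
  show "open_map ?P ?P' (map_tuple q n)"
    unfolding open_map_def
  proof (intro allI impI)
    fix W assume W: "openin ?P W"
    show "openin ?P' (map_tuple q n ` W)"
      unfolding openin_product_topology_alt
    proof (intro ballI)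
      fix y assume "y \<in> map_tuple q n ` W"
      then obtain x where x: "x \<in> W" "y = map_tuple q n x"
        by blast
      then obtain B where B: "\<forall>i\<in>{..n}. openin T (B i)" "x \<in> Pi\<^sub>E {..n} B" "Pi\<^sub>E {..n} B \<subseteq> W"
        using W unfolding openin_product_topology_alt by blast
      have "Pi\<^sub>E {..n} (\<lambda>i. q ` B i) \<subseteq> map_tuple q n ` W"
      proof
        fix z assume z: "z \<in> Pi\<^sub>E {..n} (\<lambda>i. q ` B i)"
        let ?w = "\<lambda>i\<in>{..n}. inv_into (B i) q (z i)"
        have "?w \<in> Pi\<^sub>E {..n} B"
          using z by (auto simp: PiE_iff intro: inv_into_into)
        moreover have "z = map_tuple q n ?w"
          using z by (auto simp: map_tuple_def PiE_iff extensional_def f_inv_into_f fun_eq_iff)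
        ultimately show "z \<in> map_tuple q n ` W"
          using B(3) by blast
      qed
      moreover have "y \<in> Pi\<^sub>E {..n} (\<lambda>i. q ` B i)"
        using B(2) x(2) by (auto simp: map_tuple_def PiE_iff)
      moreover have "\<forall>i\<in>{..n}. openin S (q ` B i)"
        using B(1) q_open by (auto simp: open_map_def)
      ultimately show "\<exists>U. finite {i \<in> {..n}. U i \<noteq> topspace S} \<and> (\<forall>i\<in>{..n}. openin S (U i))
          \<and> y \<in> Pi\<^sub>E {..n} U \<and> Pi\<^sub>E {..n} U \<subseteq> map_tuple q n ` W"
        by (intro exI[of _ "\<lambda>i. q ` B i"]) auto
    qed
  qed
qed

lemma map_tuple_translate:
  assumes "g \<in> carrier G" "x \<in> G.X n"
  shows "map_tuple q n (translate G n g x) = translate Q n (q g) (map_tuple q n x)"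
  using assms by (auto simp: map_tuple_def translate_def tuples_def fun_eq_iff PiE_iff)

text \<open>Continuity transfers in both directions because tuples map by a quotient map, and
  invariance because every tuple of the quotient lifts.\<close>

lemma inflation_in_cochains_iff:
  assumes f: "f \<in> Q.X n \<rightarrow>\<^sub>E carrier R" and U: "U \<subseteq> carrier G"
  shows "I n f \<in> cochains R n G T U \<longleftrightarrow> f \<in> cochains R n Q S (q ` U)"
proof -
  let ?P = "product_topology (\<lambda>_. T) {..n}" and ?P' = "product_topology (\<lambda>_. S) {..n}"
  have "I n f \<in> G.X n \<rightarrow>\<^sub>E carrier R"
    using f by (auto simp: inflation_def)
  moreover have "continuous_map ?P (discrete_topology (carrier R)) (I n f)
      \<longleftrightarrow> continuous_map ?P (discrete_topology (carrier R)) (f \<circ> map_tuple q n)"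
    by (rule iffI; erule continuous_map_eq)
      (simp_all add: G.topspace_product_tuples inflation_def del: topspace_product_topology)
  moreover have "(\<forall>u\<in>U. \<forall>x\<in>G.X n. I n f (translate G n u x) = I n f x)
      \<longleftrightarrow> (\<forall>u\<in>q ` U. \<forall>y\<in>Q.X n. f (translate Q n u y) = f y)" (is "?l \<longleftrightarrow> ?r")
  proof -
    have "I n f (translate G n u x) = f (translate Q n (q u) (map_tuple q n x))" "I n f x = f (map_tuple q n x)"
      if "u \<in> U" "x \<in> G.X n" for u x
    proof -
      have u: "u \<in> carrier G"
        using that(1) U by blast
      show "I n f (translate G n u x) = f (translate Q n (q u) (map_tuple q n x))" "I n f x = f (map_tuple q n x)"
        using that(2) by (simp_all add: inflation_def G.translate_in_tuples[OF u] map_tuple_translate[OF u])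
    qed
    then have "?l \<longleftrightarrow> (\<forall>u\<in>U. \<forall>x\<in>G.X n. f (translate Q n (q u) (map_tuple q n x)) = f (map_tuple q n x))"
      by simp
    also have "\<dots> \<longleftrightarrow> ?r"
      by (simp only: X_eq_image ball_simps)
    finally show ?thesis .
  qed
  ultimately show ?thesis
    using f continuous_compose_quotient_map_eq[OF quotient_map_map_tuple, of n _ f] by (simp add: cochains_def)
qed

text \<open>A function constant on fibres of the tuple map can be evaluated on any chosen lift;
  continuity and invariance of the result are then read off from its inflation.\<close>

lemma cochain_descends:
  assumes F: "F \<in> cochains R n G T U" and U: "U \<subseteq> carrier G"
    and eq: "\<And>x y. x \<in> G.X n \<Longrightarrow> y \<in> G.X n \<Longrightarrow> map_tuple q n x = map_tuple q n y \<Longrightarrow> F x = F y"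
  obtains f where "f \<in> cochains R n Q S (q ` U)" "F = I n f"
proof -
  define f where "f = (\<lambda>y\<in>Q.X n. F (SOME x. x \<in> G.X n \<and> map_tuple q n x = y))"
  have *: "f (map_tuple q n x) = F x" if x: "x \<in> G.X n" for x
  proof -
    let ?x = "SOME x'. x' \<in> G.X n \<and> map_tuple q n x' = map_tuple q n x"
    have "?x \<in> G.X n \<and> map_tuple q n ?x = map_tuple q n x"
      by (rule someI[of _ x]) (simp add: x)
    then have "F ?x = F x"
      using x by (intro eq) auto
    then show ?thesis
      using x by (simp add: f_def)
  qed
  have "F = I n f"
    using G.cochains_PiE[OF F] * by (auto simp: inflation_def PiE_iff extensional_def fun_eq_iff)
  moreover have "f \<in> Q.X n \<rightarrow>\<^sub>E carrier R"
  proof (rule PiE_I)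
    fix y assume "y \<in> Q.X n"
    then show "f y \<in> carrier R"
      using * G.cochains_closed[OF F] by (auto elim!: X_cases)
  qed (simp add: f_def)
  ultimately show thesis
    using that F inflation_in_cochains_iff[OF _ U] by simp
qed

lemma differential_inflation:
  assumes f: "\<And>y. y \<in> Q.X n \<Longrightarrow> f y \<in> carrier R"
  shows "differential R n G (I n f) = I (Suc n) (differential R n Q f)"
proof
  fix x
  show "differential R n G (I n f) x = I (Suc n) (differential R n Q f) x"
  proof (cases "x \<in> G.X (Suc n)")
    case True
    have F: "face n i x \<in> G.X n" for i
      using True by (rule face_in_tuples)
    have "finsum R (\<lambda>i. if even i then I n f (face n i x) else \<ominus> I n f (face n i x)) {..Suc n}
      = finsum R (\<lambda>i. if even i then f (face n i (map_tuple q (Suc n) x))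
          else \<ominus> f (face n i (map_tuple q (Suc n) x))) {..Suc n}"
      using F f by (intro G.finsum_cong') (auto simp: inflation_def face_map_tuple)
    then show ?thesis
      using True by (simp add: inflation_apply differential_def del: G.finsum_Suc)
  qed (simp add: differential_def inflation_def)
qed

lemma inflation_zero_cochain: "I n (zero_cochain R n Q) = zero_cochain R n G"
  by (auto simp: inflation_def zero_cochain_def fun_eq_iff)

lemma inflation_in_cocycles_iff:
  assumes f: "f \<in> cochains R n Q S (q ` U)" and U: "U \<subseteq> carrier G"
  shows "I n f \<in> cocycles R n G T U \<longleftrightarrow> f \<in> cocycles R n Q S (q ` U)"
proof -
  have "I n f \<in> cochains R n G T U"
    using f inflation_in_cochains_iff[OF Q.cochains_PiE[OF f] U] by simp
  moreover have "differential R n G (I n f) = I (Suc n) (differential R n Q f)"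
    using Q.cochains_closed[OF f] by (rule differential_inflation)
  moreover have "I (Suc n) (differential R n Q f) = zero_cochain R (Suc n) G
      \<longleftrightarrow> differential R n Q f = zero_cochain R (Suc n) Q"
    unfolding inflation_zero_cochain[symmetric]
    by (rule inj_on_eq_iff[OF inj_on_inflation]) (simp_all add: differential_def zero_cochain_def)
  ultimately show ?thesis
    using f by (simp add: cocycles_def)
qed

text \<open>
  The cocycle identity for \<open>a, b, c\<close> with two neighbouring entries in the same coset of \<open>K\<close>
  makes \<open>k \<mapsto> F(kx, x)\<close> a homomorphism on \<open>K\<close>, which vanishes, and then lets both entries of
  \<open>F\<close> move within their coset.
\<close>

lemma partial_cocycle_descends:
  assumes F: "F \<in> cochains R (Suc 0) G T U" and U: "subgroup U G" "K \<subseteq> U"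
    and add: "\<And>a b c. a \<in> carrier G \<Longrightarrow> b \<in> carrier G \<Longrightarrow> c \<in> carrier G \<Longrightarrow> q a = q b \<or> q b = q c \<Longrightarrow>
      F (tuple2 a b) \<oplus> F (tuple2 b c) = F (tuple2 a c)"
  obtains f where "f \<in> cochains R (Suc 0) Q S (q ` U)" "F = I (Suc 0) f"
proof -
  have K_carrier: "k \<in> carrier G" "q k = \<one>\<^bsub>Q\<^esub>" if "k \<in> K" for k
    using that by (auto simp: kernel_def)
  have closed: "F (tuple2 a b) \<in> carrier R" if "a \<in> carrier G" "b \<in> carrier G" for a b
    using G.cochains_closed[OF F] that by simp
  have vanish: "F (tuple2 (k \<otimes>\<^bsub>G\<^esub> a) a) = \<zero>" if a: "a \<in> carrier G" and k: "k \<in> K" for a k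
  proof -
    let ?h = "\<lambda>x. F (tuple2 (x \<otimes>\<^bsub>G\<^esub> a) a)"
    show ?thesis
    proof (rule hom_kernel_trivial[of ?h, OF _ _ k])
      have "continuous_map T (product_topology (\<lambda>_. T) {..Suc 0}) (\<lambda>x. tuple2 (x \<otimes>\<^bsub>G\<^esub> a) a)"
        using continuous_translation[OF a] a
        by (auto simp: continuous_map_componentwise tuple2_def G.topspace_eq)
      moreover have "continuous_map (product_topology (\<lambda>_. T) {..Suc 0}) (discrete_topology (carrier R)) F"
        using F by (simp add: cochains_def)
      ultimately show "continuous_map T (discrete_topology (carrier R)) ?h"
        using continuous_map_compose[of T _ "\<lambda>x. tuple2 (x \<otimes>\<^bsub>G\<^esub> a) a" _ F] by (simp add: o_def)
    next
      fix x y assume xy: "x \<in> K" "y \<in> K"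
      note xG = K_carrier[OF xy(1)] and yG = K_carrier[OF xy(2)]
      \<comment> \<open>The entry xa is inserted between xya and a. All three lie in the coset of a,
        so the partial cocycle identity is available.\<close>
      have "F (tuple2 (x \<otimes>\<^bsub>G\<^esub> y \<otimes>\<^bsub>G\<^esub> a) a)
          = F (tuple2 (x \<otimes>\<^bsub>G\<^esub> y \<otimes>\<^bsub>G\<^esub> a) (x \<otimes>\<^bsub>G\<^esub> a)) \<oplus> F (tuple2 (x \<otimes>\<^bsub>G\<^esub> a) a)"
        using xG yG a by (intro add[symmetric]) auto
      \<comment> \<open>The pair is the translate of (ya, a) by x, which lies in \<open>U\<close>
        because \<open>K\<close> does; invariance of F removes x.\<close>
      also have "F (tuple2 (x \<otimes>\<^bsub>G\<^esub> y \<otimes>\<^bsub>G\<^esub> a) (x \<otimes>\<^bsub>G\<^esub> a)) = F (tuple2 (y \<otimes>\<^bsub>G\<^esub> a) a)"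
        using G.cochains_translate[OF F, of x "tuple2 (y \<otimes>\<^bsub>G\<^esub> a) a"] xy(1) U(2) xG yG a
        by (auto simp: G.G.m_assoc)
      finally show "?h (x \<otimes>\<^bsub>G\<^esub> y) = ?h x \<oplus> ?h y"
        using closed xG yG a by (simp add: G.a_comm)
    qed
  qed
  have same: "F (tuple2 b a) = \<zero>" if "a \<in> carrier G" "b \<in> carrier G" "q a = q b" for a b
  proof -
    have "b \<otimes>\<^bsub>G\<^esub> inv\<^bsub>G\<^esub> a \<in> K"
      using that by (simp add: kernel_def)
    then show ?thesis
      using vanish[OF that(1), of "b \<otimes>\<^bsub>G\<^esub> inv\<^bsub>G\<^esub> a"] that by (simp add: G.G.m_assoc)
  qed
  have "F x = F y" if xy: "x \<in> G.X (Suc 0)" "y \<in> G.X (Suc 0)" "map_tuple q (Suc 0) x = map_tuple q (Suc 0) y"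
    for x y
  proof -
    obtain a b where x: "x = tuple2 a b" and ab: "a \<in> carrier G" "b \<in> carrier G"
      using xy(1) by (rule tuples_Suc_0_cases)
    obtain c d where y: "y = tuple2 c d" and cd: "c \<in> carrier G" "d \<in> carrier G"
      using xy(2) by (rule tuples_Suc_0_cases)
    have "tuple2 (q a) (q b) 0 = tuple2 (q c) (q d) 0"
      "tuple2 (q a) (q b) (Suc 0) = tuple2 (q c) (q d) (Suc 0)"
      using xy(3) by (simp_all add: x y)
    then have q: "q a = q c" "q b = q d"
      by (simp_all add: tuple2_def)
    \<comment> \<open>The passage from a to b is routed through c and d. Its two outer pieces stay
      within one coset and vanish, leaving F(c, d).\<close>
    have "F (tuple2 a b) = F (tuple2 a c) \<oplus> (F (tuple2 c d) \<oplus> F (tuple2 d b))"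
      using add[of a c b] add[of c d b] ab cd q by simp
    then show ?thesis
      using same[of c a] same[of b d] ab cd q closed by (simp add: x y)
  qed
  then show thesis
    using cochain_descends[OF F subgroup.subset[OF U(1)]] that by blast
qed

text \<open>A cocycle satisfies the additivity on all triples, in particular on those demanded by
  \<open>partial_cocycle_descends\<close>.\<close>

lemma cocycles_eq_inflation:
  assumes U: "subgroup U G" "K \<subseteq> U"
  shows "cocycles R (Suc 0) G T U = I (Suc 0) ` cocycles R (Suc 0) Q S (q ` U)"
proof (intro equalityI subsetI)
  fix F assume F: "F \<in> cocycles R (Suc 0) G T U"
  then have "F \<in> cochains R (Suc 0) G T U"
    by (simp add: cocycles_def)
  then obtain f where "f \<in> cochains R (Suc 0) Q S (q ` U)" "F = I (Suc 0) f"
    using partial_cocycle_descends[OF _ U] G.cocycle_add[OF F] by metis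
  then show "F \<in> I (Suc 0) ` cocycles R (Suc 0) Q S (q ` U)"
    using F inflation_in_cocycles_iff subgroup.subset[OF U(1)] by blast
next
  fix F assume "F \<in> I (Suc 0) ` cocycles R (Suc 0) Q S (q ` U)"
  then show "F \<in> cocycles R (Suc 0) G T U"
    using inflation_in_cocycles_iff[OF _ subgroup.subset[OF U(1)]] by (auto simp: cocycles_def)
qed

lemma cup_cochain_inflation:
  "cup_cochain R m n G (I m f) (I n g) = I (m + n) (cup_cochain R m n Q f g)"
proof
  fix x
  show "cup_cochain R m n G (I m f) (I n g) x = I (m + n) (cup_cochain R m n Q f g) x"
  proof (cases "x \<in> G.X (m + n)")
    case True
    then have "(\<lambda>i\<in>{..m}. x i) \<in> G.X m" "(\<lambda>i\<in>{..n}. x (m + i)) \<in> G.X n"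
      by (auto simp: tuples_def)
    moreover have "map_tuple q m (\<lambda>i\<in>{..m}. x i) = (\<lambda>i\<in>{..m}. map_tuple q (m + n) x i)"
      "map_tuple q n (\<lambda>i\<in>{..n}. x (m + i)) = (\<lambda>i\<in>{..n}. map_tuple q (m + n) x (m + i))"
      by (auto simp: map_tuple_def fun_eq_iff)
    ultimately show ?thesis
      using True by (simp add: cup_cochain_def inflation_def)
  qed (simp add: cup_cochain_def inflation_def)
qed

end

lemma map_tuple_tuple3 [simp]:
  "map_tuple q (Suc (Suc 0)) (tuple3 a b c) = tuple3 (q a) (q b) (q c)"
  by (auto simp: map_tuple_def tuple3_def fun_eq_iff)

lemma (in cochain_setting) cup_cochain_tuple3:
  assumes "a \<in> carrier G" "b \<in> carrier G" "c \<in> carrier G"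
  shows "cup_cochain R (Suc 0) (Suc 0) G f g (tuple3 a b c) = f (tuple2 a b) \<otimes> g (tuple2 b c)"
proof -
  have "(\<lambda>i\<in>{..Suc 0}. tuple3 a b c i) = tuple2 a b" "(\<lambda>i\<in>{..Suc 0}. tuple3 a b c (Suc 0 + i)) = tuple2 b c"
    by (auto simp: tuple3_def tuple2_def fun_eq_iff)
  then show ?thesis
    using assms by (simp add: cup_cochain_def)
qed

text \<open>With singleton classes, the union defining the corestriction is just the set of norms of
  all invariant cocycles extending F.\<close>

lemma (in cochain_setting) corestriction_singleton:
  assumes U: "subgroup U G"
  shows "corestriction R (Suc 0) G T U {F} =
    norm_cochain R (Suc 0) G U ` {f \<in> cocycles R (Suc 0) G T U. restrict f (tuples (Suc 0) U) = F}"
proof -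
  have "cohomology_class R (Suc 0) G T (norm_cochain R (Suc 0) G U f) = {norm_cochain R (Suc 0) G U f}"
    if "f \<in> cocycles R (Suc 0) G T U" for f
    using that by (intro cohomology_class_Suc_0 norm_cochain_closed[OF U]) (auto simp: cocycles_def cochains_closed)
  then show ?thesis
    by (auto simp: corestriction_def)
qed

lemma translate_mult:
  assumes "group G" "g \<in> carrier G" "h \<in> carrier G" "x \<in> tuples n (carrier G)"
  shows "translate G n (g \<otimes>\<^bsub>G\<^esub> h) x = translate G n g (translate G n h x)"
  using assms by (auto simp: translate_def tuples_def fun_eq_iff PiE_iff group.is_monoid monoid.m_assoc)

section \<open>Cosets under a surjective homomorphism\<close>

context group_hom
begin

lemma image_l_coset:
  assumes "a \<in> carrier G" "U \<subseteq> carrier G"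
  shows "h ` (a <# U) = h a <#\<^bsub>H\<^esub> h ` U"
  using assms by (auto simp: l_coset_def image_iff subset_iff)

text \<open>Injectivity rests on \<open>U\<close> containing the kernel: two representatives with
  images in the same coset then differ by an element of \<open>U\<close>.\<close>

lemma bij_betw_lcosets:
  assumes surj: "h ` carrier G = carrier H" and U: "subgroup U G" "kernel G H h \<subseteq> U"
  shows "bij_betw ((`) h) (lcosets U) (lcosets\<^bsub>H\<^esub> (h ` U))"
proof -
  have UG: "U \<subseteq> carrier G"
    using U(1) by (rule subgroup.subset)
  have "inj_on ((`) h) (lcosets U)"
  proof (rule inj_onI)
    fix A B assume "A \<in> lcosets U" "B \<in> lcosets U" and eq: "h ` A = h ` B"
    then obtain a b where ab: "a \<in> carrier G" "b \<in> carrier G" "A = a <# U" "B = b <# U"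
      by (auto simp: LCOSETS_def)
    then have "h a \<in> h ` B"
      using eq G.lcos_self[OF ab(1) U(1)] by blast
    then obtain u where u: "u \<in> U" "h a = h (b \<otimes> u)"
      using ab(4) by (auto simp: l_coset_def)
    have uG: "u \<in> carrier G"
      using u(1) UG by blast
    have "inv (b \<otimes> u) \<otimes> a \<in> kernel G H h"
      using u(2)[symmetric] uG ab(1,2) hom_mult[of "inv (b \<otimes> u)" a] hom_inv[of "b \<otimes> u"]
      by (simp add: kernel_def del: hom_mult)
    then have k: "inv (b \<otimes> u) \<otimes> a \<in> U"
      using U(2) by blast
    have "a = b \<otimes> (u \<otimes> (inv (b \<otimes> u) \<otimes> a))"
      using uG ab(1,2) by (simp add: G.m_assoc[symmetric])
    moreover have "u \<otimes> (inv (b \<otimes> u) \<otimes> a) \<in> U"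
      using subgroup.m_closed[OF U(1) u(1) k] .
    ultimately have "a \<in> b <# U"
      unfolding l_coset_def by blast
    then show "A = B"
      using G.l_repr_independence[OF _ ab(2) U(1)] ab(3,4) by blast
  qed
  moreover have "(`) h ` (lcosets U) = lcosets\<^bsub>H\<^esub> (h ` U)"
    using image_l_coset[OF _ UG] by (auto simp: LCOSETS_def surj[symmetric] image_UN)
  ultimately show ?thesis
    by (simp add: bij_betw_def)
qed

text \<open>The index in the Kijima-Nishi property counts right cosets while the norm sums over left
  ones; for normal subgroups the two families coincide.\<close>

lemma card_rcosets_image:
  assumes surj: "h ` carrier G = carrier H" and U: "U \<lhd> G" "kernel G H h \<subseteq> U"
  shows "card (rcosets\<^bsub>H\<^esub> (h ` U)) = card (rcosets U)"
proof -
  have "rcosets U = lcosets U" "rcosets\<^bsub>H\<^esub> (h ` U) = lcosets\<^bsub>H\<^esub> (h ` U)"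
    using normal.coset_eq[OF U(1)]
      normal.coset_eq[OF normal.surj_hom_normal_subgroup[OF U(1) group_hom_axioms surj]]
    by (simp_all add: RCOSETS_def LCOSETS_def)
  then show ?thesis
    using bij_betw_same_card[OF bij_betw_lcosets[OF surj normal_imp_subgroup[OF U(1)] U(2)]] by simp
qed

end

section \<open>Cup products, norms and corestriction under inflation\<close>

context inflation_setting
begin

lemma K_subset: "K \<subseteq> carrier G"
  by (auto simp: kernel_def)

text \<open>The direction from \<open>G\<close> to \<open>Q\<close> is injectivity of inflation on
  H^2 for these products. Cocycles vanish on the diagonal, so f(a, b) g(b, c) is zero when a = b or
  b = c in \<open>Q\<close>. A bounding cochain on \<open>G\<close> is therefore additive on the
  triples concerned and itself descends, without any correction.\<close>

lemma cup_coboundary_iff: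
  assumes f: "f \<in> cocycles R (Suc 0) Q S (carrier Q)" and g: "g \<in> cocycles R (Suc 0) Q S (carrier Q)"
  defines "c \<equiv> cup_cochain R (Suc 0) (Suc 0) Q f g"
  shows "I (Suc (Suc 0)) c \<in> coboundaries R (Suc (Suc 0)) G T (carrier G)
    \<longleftrightarrow> c \<in> coboundaries R (Suc (Suc 0)) Q S (carrier Q)"
proof -
  let ?CG = "cochains R (Suc 0) G T (carrier G)" and ?CQ = "cochains R (Suc 0) Q S (carrier Q)"
  have cob: "coboundaries R (Suc (Suc 0)) G T (carrier G) = differential R (Suc 0) G ` ?CG"
    "coboundaries R (Suc (Suc 0)) Q S (carrier Q) = differential R (Suc 0) Q ` ?CQ"
    by (simp_all add: coboundaries_def)
  have dI: "differential R (Suc 0) G (I (Suc 0) h) = I (Suc (Suc 0)) (differential R (Suc 0) Q h)"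
    if "h \<in> ?CQ" for h
    using Q.cochains_closed[OF that] by (rule differential_inflation)
  have fc: "f \<in> ?CQ" and gc: "g \<in> ?CQ"
    using f g by (simp_all add: cocycles_def)
  have c_ext: "c \<in> extensional (Q.X (Suc (Suc 0)))"
    by (simp add: c_def cup_cochain_def)
  show ?thesis
    unfolding cob
  proof
    assume "c \<in> differential R (Suc 0) Q ` ?CQ"
    then obtain h where h: "h \<in> ?CQ" "c = differential R (Suc 0) Q h"
      by blast
    have "I (Suc 0) h \<in> ?CG"
      using h(1) inflation_in_cochains_iff[OF Q.cochains_PiE[OF h(1)] subset_refl] by (simp add: q_surj)
    then show "I (Suc (Suc 0)) c \<in> differential R (Suc 0) G ` ?CG"
      using dI[OF h(1)] h(2) by (metis imageI)
  next
    assume "I (Suc (Suc 0)) c \<in> differential R (Suc 0) G ` ?CG"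
    then obtain H where H: "H \<in> ?CG" "I (Suc (Suc 0)) c = differential R (Suc 0) G H"
      by blast
    have add: "H (tuple2 x y) \<oplus> H (tuple2 y z) = H (tuple2 x z)"
      if xyz: "x \<in> carrier G" "y \<in> carrier G" "z \<in> carrier G" "q x = q y \<or> q y = q z" for x y z
    proof -
      have "f (tuple2 (q x) (q y)) \<in> carrier R" "g (tuple2 (q y) (q z)) \<in> carrier R"
        using Q.cochains_closed[OF fc] Q.cochains_closed[OF gc] xyz by simp_all
      moreover have "f (tuple2 (q x) (q y)) = \<zero> \<or> g (tuple2 (q y) (q z)) = \<zero>"
        using xyz Q.cocycle_diagonal[OF f, of "q y"] Q.cocycle_diagonal[OF g, of "q y"] by auto
      ultimately have "f (tuple2 (q x) (q y)) \<otimes> g (tuple2 (q y) (q z)) = \<zero>"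
        by auto
      then have "I (Suc (Suc 0)) c (tuple3 x y z) = \<zero>"
        using xyz by (simp add: inflation_apply c_def Q.cup_cochain_tuple3)
      then show ?thesis
        using xyz H G.cochains_closed[OF H(1)]
        by (simp add: G.differential_tuple3 G.add_neg_cancel_iff)
    qed
    obtain h where h: "h \<in> cochains R (Suc 0) Q S (q ` carrier G)" "H = I (Suc 0) h"
      using partial_cocycle_descends[OF H(1) G.G.subgroup_self K_subset add] by blast
    then have hQ: "h \<in> ?CQ"
      by (simp add: q_surj)
    have "I (Suc (Suc 0)) c = I (Suc (Suc 0)) (differential R (Suc 0) Q h)"
      using H(2) h(2) dI[OF hQ] by simp
    then have "c = differential R (Suc 0) Q h"
      using inj_onD[OF inj_on_inflation _ c_ext] by (simp add: differential_def)
    then show "c \<in> differential R (Suc 0) Q ` ?CQ"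
      using hQ by blast
  qed
qed

lemma radical_cocycles_inflation: "radical_cocycles R G T = I (Suc 0) ` radical_cocycles R Q S"
proof -
  have "cocycles R (Suc 0) G T (carrier G) = I (Suc 0) ` cocycles R (Suc 0) Q S (carrier Q)"
    using cocycles_eq_inflation[OF G.G.subgroup_self K_subset] by (simp add: q_surj)
  moreover have "cup_cochain R (Suc 0) (Suc 0) G (I (Suc 0) f) (I (Suc 0) g)
        \<in> coboundaries R (Suc (Suc 0)) G T (carrier G)
      \<longleftrightarrow> cup_cochain R (Suc 0) (Suc 0) Q f g \<in> coboundaries R (Suc (Suc 0)) Q S (carrier Q)"
    if "f \<in> cocycles R (Suc 0) Q S (carrier Q)" "g \<in> cocycles R (Suc 0) Q S (carrier Q)" for f g
    using cup_coboundary_iff[OF that] by (simp add: cup_cochain_inflation)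
  ultimately show ?thesis
    unfolding radical_cocycles_def by (auto simp: image_iff)
qed

text \<open>The representatives chosen for a coset S and for its image need not correspond under
  \<open>q\<close>. They differ by an element of q(U), which the invariance of f absorbs; the two
  sums then match coset by coset.\<close>

lemma norm_cochain_inflation:
  assumes U: "subgroup U G" "K \<subseteq> U" and f: "f \<in> cochains R n Q S (q ` U)"
  shows "norm_cochain R n G U (I n f) = I n (norm_cochain R n Q (q ` U) f)"
proof
  fix x
  show "norm_cochain R n G U (I n f) x = I n (norm_cochain R n Q (q ` U) f) x"
  proof (cases "x \<in> G.X n")
    case True
    define y where "y = map_tuple q n x"
    have y: "y \<in> Q.X n"
      using True by (simp add: y_def)
    let ?s = "\<lambda>S. SOME s. s \<in> S"
    let ?t = "\<lambda>S'. f (translate Q n (inv\<^bsub>Q\<^esub> (?s S')) y)"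
    have qU: "subgroup (q ` U) Q"
      using U(1) by (rule q.subgroup_img_is_subgroup)
    have eq: "I n f (translate G n (inv\<^bsub>G\<^esub> (?s S)) x) = ?t (q ` S)"
      and closed: "?t (q ` S) \<in> carrier R" if S: "S \<in> lcosets\<^bsub>G\<^esub> U" for S
    proof -
      obtain a where a: "a \<in> carrier G" "S = a <#\<^bsub>G\<^esub> U"
        using S by (auto simp: LCOSETS_def)
      have "?s S \<in> S"
        using G.G.lcos_self[OF a(1) U(1)] unfolding a(2)[symmetric] by (rule someI)
      then obtain u where u: "u \<in> U" "?s S = a \<otimes>\<^bsub>G\<^esub> u"
        unfolding a(2) l_coset_def by blast
      have "?s (q ` S) \<in> q ` S"
        using imageI[OF \<open>?s S \<in> S\<close>] by (rule someI)
      then obtain v where v: "v \<in> U" "?s (q ` S) = q (a \<otimes>\<^bsub>G\<^esub> v)"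
        unfolding a(2) l_coset_def by blast
      have uvG: "u \<in> carrier G" "v \<in> carrier G"
        using u(1) v(1) U(1) by (simp_all add: subgroup.mem_carrier)
      \<comment> \<open>Correction between the two representatives: since (av)^-1 = (v^-1 u)(au)^-1,
        the inverse representatives in \<open>Q\<close> differ by left multiplication by
        \<open>w\<close>.\<close>
      define w where "w = q (inv\<^bsub>G\<^esub> v \<otimes>\<^bsub>G\<^esub> u)"
      have w: "w \<in> q ` U"
        unfolding w_def
        by (intro imageI subgroup.m_closed[OF U(1)] subgroup.m_inv_closed[OF U(1)] u(1) v(1))
      then have wQ: "w \<in> carrier Q"
        using subgroup.mem_carrier[OF qU] by blast
      have "inv\<^bsub>G\<^esub> (a \<otimes>\<^bsub>G\<^esub> v) = inv\<^bsub>G\<^esub> v \<otimes>\<^bsub>G\<^esub> u \<otimes>\<^bsub>G\<^esub> inv\<^bsub>G\<^esub> (a \<otimes>\<^bsub>G\<^esub> u)"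
      proof -
        have "u \<otimes>\<^bsub>G\<^esub> (inv\<^bsub>G\<^esub> u \<otimes>\<^bsub>G\<^esub> inv\<^bsub>G\<^esub> a) = inv\<^bsub>G\<^esub> a"
          using a(1) uvG by (simp add: G.G.m_assoc[symmetric])
        then show ?thesis
          using a(1) uvG by (simp add: G.G.inv_mult_group G.G.m_assoc)
      qed
      then have "q (inv\<^bsub>G\<^esub> (a \<otimes>\<^bsub>G\<^esub> v)) = w \<otimes>\<^bsub>Q\<^esub> q (inv\<^bsub>G\<^esub> (a \<otimes>\<^bsub>G\<^esub> u))"
        using a(1) uvG by (simp add: w_def del: q.hom_inv G.G.inv_mult_group)
      then have inv: "inv\<^bsub>Q\<^esub> (?s (q ` S)) = w \<otimes>\<^bsub>Q\<^esub> inv\<^bsub>Q\<^esub> (q (?s S))"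
        using a(1) uvG u(2) v(2) by (metis G.G.m_closed q.hom_inv)
      have sS: "?s S \<in> carrier G"
        using a(1) uvG u(2) by simp
      have z: "translate Q n (inv\<^bsub>Q\<^esub> (q (?s S))) y \<in> Q.X n"
        using sS y by (intro Q.translate_in_tuples) auto
      have "?t (q ` S) = f (translate Q n (inv\<^bsub>Q\<^esub> (q (?s S))) y)"
        unfolding inv
        using translate_mult[OF Q.G.is_group wQ, of "inv\<^bsub>Q\<^esub> (q (?s S))" y n]
          Q.cochains_translate[OF f w z] sS y by simp
      moreover have "I n f (translate G n (inv\<^bsub>G\<^esub> (?s S)) x) = f (translate Q n (inv\<^bsub>Q\<^esub> (q (?s S))) y)"
        using sS True G.translate_in_tuples[of "inv\<^bsub>G\<^esub> (?s S)" x n]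
        by (simp add: inflation_apply map_tuple_translate y_def)
      ultimately show "I n f (translate G n (inv\<^bsub>G\<^esub> (?s S)) x) = ?t (q ` S)" "?t (q ` S) \<in> carrier R"
        using Q.cochains_closed[OF f z] by simp_all
    qed
    have bij: "bij_betw ((`) q) (lcosets\<^bsub>G\<^esub> U) (lcosets\<^bsub>Q\<^esub> (q ` U))"
      using q_surj U by (rule q.bij_betw_lcosets)
    have "finsum R (\<lambda>S. I n f (translate G n (inv\<^bsub>G\<^esub> (?s S)) x)) (lcosets\<^bsub>G\<^esub> U)
      = finsum R (\<lambda>S. ?t (q ` S)) (lcosets\<^bsub>G\<^esub> U)"
      using eq closed by (intro G.finsum_cong') auto
    also have "\<dots> = finsum R ?t ((`) q ` (lcosets\<^bsub>G\<^esub> U))"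
      using closed bij_betw_imp_inj_on[OF bij] by (intro G.finsum_reindex[symmetric]) auto
    finally show ?thesis
      using True y bij by (simp add: norm_cochain_def inflation_apply y_def bij_betw_def)
  qed (simp add: norm_cochain_def inflation_def)
qed

text \<open>The invariant cocycles of \<open>G\<close> that extend the inflation of
  \<open>f0\<close> are exactly the inflations of those of \<open>Q\<close> extending
  \<open>f0\<close>, because tuples of \<open>U\<close> surject onto tuples of q(U). Norms of both
  correspond by \<open>norm_cochain_inflation\<close>.\<close>

lemma corestriction_inflation:
  assumes U: "subgroup U G" "K \<subseteq> U" and f0: "f0 \<in> extensional (tuples (Suc 0) (q ` U))"
  shows "corestriction R (Suc 0) G T U {inflation (G\<lparr>carrier := U\<rparr>) q (Suc 0) f0}
    = I (Suc 0) ` corestriction R (Suc 0) Q S (q ` U) {f0}"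
proof -
  let ?c = "cocycles R (Suc 0) Q S (q ` U)"
  have UG: "U \<subseteq> carrier G"
    using U(1) by (rule subgroup.subset)
  have qU: "subgroup (q ` U) Q"
    using U(1) by (rule q.subgroup_img_is_subgroup)
  have "restrict (I (Suc 0) f) (tuples (Suc 0) U) = inflation (G\<lparr>carrier := U\<rparr>) q (Suc 0) f0
      \<longleftrightarrow> restrict f (tuples (Suc 0) (q ` U)) = f0" for f
  proof -
    have "tuples (Suc 0) U \<subseteq> G.X (Suc 0)"
      using UG by (auto simp: tuples_def)
    then have "restrict (I (Suc 0) f) (tuples (Suc 0) U) = inflation (G\<lparr>carrier := U\<rparr>) q (Suc 0) f0
      \<longleftrightarrow> (\<forall>x\<in>tuples (Suc 0) U. f (map_tuple q (Suc 0) x) = f0 (map_tuple q (Suc 0) x))"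
      by (auto simp: inflation_def fun_eq_iff subset_iff)
    also have "\<dots> \<longleftrightarrow> (\<forall>y\<in>tuples (Suc 0) (q ` U). f y = f0 y)"
      by (simp only: map_tuple_image[symmetric] ball_simps)
    also have "\<dots> \<longleftrightarrow> restrict f (tuples (Suc 0) (q ` U)) = f0"
      using f0 by (auto simp: fun_eq_iff extensional_def)
    finally show ?thesis .
  qed
  then have "{F \<in> cocycles R (Suc 0) G T U. restrict F (tuples (Suc 0) U) = inflation (G\<lparr>carrier := U\<rparr>) q (Suc 0) f0}
    = I (Suc 0) ` {f \<in> ?c. restrict f (tuples (Suc 0) (q ` U)) = f0}"
    unfolding cocycles_eq_inflation[OF U] by auto
  moreover have "norm_cochain R (Suc 0) G U (I (Suc 0) f) = I (Suc 0) (norm_cochain R (Suc 0) Q (q ` U) f)"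
    if "f \<in> ?c" for f
    using norm_cochain_inflation[OF U] that by (simp add: cocycles_def)
  ultimately show ?thesis
    unfolding G.corestriction_singleton[OF U(1)] Q.corestriction_singleton[OF qU]
    by (auto simp: image_image)
qed

end

text \<open>
  The whole diagram formed by the radicals of \<open>U\<close> and \<open>G\<close> and the corestriction between them is
  the image under inflation of the one for \<open>q(U)\<close> and \<open>Q\<close>, and inflation is injective.
\<close>

lemma corestriction_radical_inflation_iff:
  assumes "inflation_setting (residue_ring (int p)) G T Q S q"
    and "inflation_setting (residue_ring (int p)) (G\<lparr>carrier := U\<rparr>) (subtopology T U)
      (Q\<lparr>carrier := q ` U\<rparr>) (subtopology S (q ` U)) q"
    and U: "subgroup U G" "kernel G Q q \<subseteq> U"
  shows "corestriction (residue_ring (int p)) 1 G T U ` cup_radical p (G\<lparr>carrier := U\<rparr>) (subtopology T U)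
      = cup_radical p G T \<longleftrightarrow>
    corestriction (residue_ring (int p)) 1 Q S (q ` U) ` cup_radical p (Q\<lparr>carrier := q ` U\<rparr>) (subtopology S (q ` U))
      = cup_radical p Q S"
proof -
  let ?R = "residue_ring (int p)"
  interpret I: inflation_setting ?R G T Q S q
    by fact
  interpret J: inflation_setting ?R "G\<lparr>carrier := U\<rparr>" "subtopology T U"
      "Q\<lparr>carrier := q ` U\<rparr>" "subtopology S (q ` U)" q
    by fact
  let ?radU = "radical_cocycles ?R (Q\<lparr>carrier := q ` U\<rparr>) (subtopology S (q ` U))"
  let ?radQ = "radical_cocycles ?R Q S"
  let ?corG = "corestriction ?R (Suc 0) G T U" and ?corQ = "corestriction ?R (Suc 0) Q S (q ` U)"
  have qU: "subgroup (q ` U) Q"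
    using U(1) by (rule I.q.subgroup_img_is_subgroup)
  have ext: "f \<in> extensional (I.Q.X (Suc 0))" if "f \<in> cocycles ?R (Suc 0) Q S V" for f V
    using that by (auto simp: cocycles_def cochains_def PiE_iff)
  have radU_ext: "f \<in> extensional (tuples (Suc 0) (q ` U))" if "f \<in> ?radU" for f
    using that by (auto simp: radical_cocycles_def cocycles_def cochains_def PiE_iff)
  have "?corG ` cup_radical p (G\<lparr>carrier := U\<rparr>) (subtopology T U) = (`) (I.I (Suc 0)) ` ((\<lambda>f. ?corQ {f}) ` ?radU)"
    unfolding cup_radical_eq[OF J.G.cochain_setting_axioms] J.radical_cocycles_inflation image_image
    using I.corestriction_inflation[OF U radU_ext] by (intro image_cong) auto
  moreover have "cup_radical p G T = (`) (I.I (Suc 0)) ` ((\<lambda>f. {f}) ` ?radQ)"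
    unfolding cup_radical_eq[OF I.G.cochain_setting_axioms] I.radical_cocycles_inflation image_image
    by simp
  \<comment> \<open>Both sides of the equation to be compared are families of sets of cochains, so
    injectivity of inflation has to be lifted to sets of extensional functions.\<close>
  moreover have "inj_on ((`) (I.I (Suc 0))) (Pow (extensional (I.Q.X (Suc 0))))"
    by (rule inj_on_image_Pow[OF I.inj_on_inflation])
  moreover have "(\<lambda>f. ?corQ {f}) ` ?radU \<subseteq> Pow (extensional (I.Q.X (Suc 0)))"
    unfolding I.Q.corestriction_singleton[OF qU] by (auto simp: norm_cochain_def)
  moreover have "(\<lambda>f. {f}) ` ?radQ \<subseteq> Pow (extensional (I.Q.X (Suc 0)))"
    using ext by (auto simp: radical_cocycles_def)
  ultimately have "?corG ` cup_radical p (G\<lparr>carrier := U\<rparr>) (subtopology T U) = cup_radical p G T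
    \<longleftrightarrow> (\<lambda>f. ?corQ {f}) ` ?radU = (\<lambda>f. {f}) ` ?radQ"
    by (simp add: inj_on_image_eq_iff)
  also have "\<dots> \<longleftrightarrow> ?corQ ` cup_radical p (Q\<lparr>carrier := q ` U\<rparr>) (subtopology S (q ` U)) = cup_radical p Q S"
    unfolding cup_radical_eq[OF I.Q.cochain_setting_axioms] cup_radical_eq[OF J.Q.cochain_setting_axioms] image_image ..
  finally show ?thesis
    by simp
qed

section \<open>The maximal pro-\<open>p\<close> quotient map\<close>

context profinite_group
begin

text \<open>A point of the saturation of W has the form n w with n in N, and the translate n W is an
  open neighbourhood of it inside the saturation.\<close>

lemma open_map_quotient_topology:
  assumes "N \<lhd> G"
  shows "open_map T (quotient_topology T (\<lambda>g. N #> g)) (\<lambda>g. N #> g)"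
  unfolding open_map_def
proof (intro allI impI)
  interpret N: normal N G by fact
  fix W assume W: "openin T W"
  then have WG: "W \<subseteq> carrier G"
    using openin_subset topspace_eq_carrier by blast
  let ?P = "{x \<in> topspace T. N #> x \<in> (\<lambda>g. N #> g) ` W}"
  have "\<exists>B. openin T B \<and> x \<in> B \<and> B \<subseteq> ?P" if x: "x \<in> ?P" for x
  proof -
    obtain w where w: "w \<in> W" "N #> x = N #> w" and xG: "x \<in> carrier G"
      using x by (auto simp: topspace_eq_carrier)
    have wG: "w \<in> carrier G"
      using w(1) WG by blast
    have "x \<in> N #> w"
      using rcos_self[OF xG N.subgroup_axioms] w(2) by simp
    then obtain n where n: "n \<in> N" "x = n \<otimes> w"
      unfolding r_coset_def by blast
    then have nG: "n \<in> carrier G" and inv_n: "inv n \<in> N"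
      by simp_all
    let ?B = "{y \<in> topspace T. inv n \<otimes> y \<in> W}"
    have "openin T ?B"
      using continuous_map_mult_left[of "inv n"] nG W by (simp add: openin_continuous_map_preimage)
    moreover have "x \<in> ?B"
      using w(1) wG nG n(2) by (simp add: topspace_eq_carrier m_assoc[symmetric])
    moreover have "N #> y \<in> (\<lambda>g. N #> g) ` W" if "y \<in> ?B" for y
    proof -
      have y: "y \<in> carrier G" "inv n \<otimes> y \<in> W"
        using that by (simp_all add: topspace_eq_carrier)
      have "N #> (inv n \<otimes> y) = N #> y"
        using coset_mult_assoc[OF N.subset _ y(1), of "inv n"] nG
          coset_join2[OF _ N.subgroup_axioms inv_n] by simp
      then show ?thesis
        using y(2) by (metis imageI)
    qed
    ultimately show ?thesis
      by (intro exI[of _ ?B]) auto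
  qed
  then have "openin T ?P"
    by (subst openin_subopen) blast
  then show "openin (quotient_topology T (\<lambda>g. N #> g)) ((\<lambda>g. N #> g) ` W)"
    using WG by (auto simp: openin_quotient_topology topspace_eq_carrier)
qed

text \<open>Apply \<open>pro_p_kernel_subset\<close> to the kernel of h on K. The zero set of h in
  \<open>U\<close> is open in the whole group, which provides \<open>W\<close>, and h(x^p) = p h(x)
  = 0 modulo p provides the condition on p-th powers. The domain \<open>U\<close> allows for
  cochains on open subgroups.\<close>

lemma pro_p_kernel_hom_trivial:
  assumes p: "prime p" and U: "openin T U" "pro_p_kernel p G T \<subseteq> U"
    and h: "continuous_map (subtopology T U) (discrete_topology {0..int p - 1}) h"
    and hom: "\<And>x y. x \<in> pro_p_kernel p G T \<Longrightarrow> y \<in> pro_p_kernel p G T \<Longrightarrow>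
      h (x \<otimes> y) = (h x + h y) mod int p"
    and k: "k \<in> pro_p_kernel p G T"
  shows "h k = 0"
proof -
  define K where "K = pro_p_kernel p G T"
  interpret K: normal K G
    unfolding K_def using p by (rule pro_p_kernel_normal)
  have UG: "U \<subseteq> carrier G"
    using U(1) openin_subset topspace_eq_carrier by blast
  have range: "h x \<in> {0..int p - 1}" if "x \<in> K" for x
    using continuous_map_image_subset_topspace[OF h] that U(2) UG
    by (auto simp: K_def topspace_eq_carrier image_subset_iff)
  have mod_range: "h x mod int p = h x" if "x \<in> K" for x
    using range[OF that] by simp
  note hom = hom[folded K_def]
  have one: "h \<one> = 0"
  proof -
    have "(h \<one> + h \<one>) mod int p = h \<one> mod int p"
      using hom[of \<one> \<one>] mod_range[of \<one>] by simp
    then have "int p dvd h \<one>"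
      by (simp add: mod_eq_dvd_iff)
    then show ?thesis
      using range[of \<one>] mod_range[of \<one>] by simp
  qed
  have pow: "h (x [^] n) = (int n * h x) mod int p" if "x \<in> K" for x and n :: nat
  proof (induction n)
    case (Suc n)
    have "h (x [^] Suc n) = (h (x [^] n) + h x) mod int p"
      using hom[OF subgroup_nat_pow_closed[OF K.subgroup_axioms that, of n] that] by simp
    then show ?case
      by (simp add: Suc mod_simps algebra_simps)
  qed (simp add: one)
  define A where "A = {x \<in> K. h x = 0}"
  have "subgroup A G"
  proof (rule subgroupI)
    show "A \<subseteq> carrier G"
      using K.subset by (auto simp: A_def)
    have "\<one> \<in> A"
      using one by (simp add: A_def)
    then show "A \<noteq> {}"
      by blast
    show "inv x \<in> A" if "x \<in> A" for x
    proof -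
      have x: "x \<in> K" "h x = 0"
        using that by (simp_all add: A_def)
      then have "h (inv x) = 0"
        using hom[of "inv x" x] one mod_range[of "inv x"] by simp
      then show ?thesis
        using x(1) by (simp add: A_def)
    qed
    show "x \<otimes> y \<in> A" if "x \<in> A" "y \<in> A" for x y
      using that hom[of x y] by (simp add: A_def)
  qed
  moreover have "openin T {x \<in> topspace (subtopology T U). h x \<in> {0}}"
  proof (rule openin_trans_full[OF openin_continuous_map_preimage[OF h] U(1)])
    show "openin (discrete_topology {0..int p - 1}) {0}"
      using prime_gt_0_nat[OF p] by simp
  qed
  moreover have "\<one> \<in> {x \<in> topspace (subtopology T U). h x \<in> {0}}"
    using one U(2) K.one_closed by (auto simp: K_def topspace_eq_carrier)
  moreover have "K \<inter> {x \<in> topspace (subtopology T U). h x \<in> {0}} \<subseteq> A"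
    by (auto simp: A_def)
  moreover have "x [^] p \<in> A" if "x \<in> K" for x
    using pow[OF that, of p] subgroup_nat_pow_closed[OF K.subgroup_axioms that] by (simp add: A_def)
  ultimately have "K \<subseteq> A"
    unfolding K_def by (rule pro_p_kernel_subset[OF p])
  then show ?thesis
    using k by (auto simp: A_def K_def)
qed

text \<open>The kernel of U -> q(U) is the pro-p kernel of \<open>G\<close>, as \<open>U\<close>
  contains it. Hence \<open>pro_p_kernel_hom_trivial\<close> settles \<open>U\<close> directly, and
  the pro-p kernel of \<open>U\<close> itself never has to be compared.\<close>

lemma inflation_setting_pro_p:
  assumes p: "prime p" and U: "subgroup U G" "openin T U" "pro_p_kernel p G T \<subseteq> U"
  defines "q \<equiv> \<lambda>g. pro_p_kernel p G T #> g"
  shows "inflation_setting (residue_ring (int p)) (G\<lparr>carrier := U\<rparr>) (subtopology T U)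
    ((max_pro_p_quotient p G T)\<lparr>carrier := q ` U\<rparr>)
    (subtopology (max_pro_p_quotient_topology p G T) (q ` U)) q"
proof -
  define K where "K = pro_p_kernel p G T"
  let ?R = "residue_ring (int p)"
  let ?Q = "max_pro_p_quotient p G T" and ?S = "max_pro_p_quotient_topology p G T"
  have q: "q = (\<lambda>g. K #> g)" and Q: "?Q = G Mod K" and S: "?S = quotient_topology T q"
    by (simp_all add: q_def K_def max_pro_p_quotient_def max_pro_p_quotient_topology_def)
  interpret K: normal K G
    unfolding K_def using p by (rule pro_p_kernel_normal)
  interpret Q: group ?Q
    unfolding Q by (rule K.factorgroup_is_group)
  have hom: "q \<in> hom G ?Q"
    unfolding q Q by (rule K.r_coset_hom_Mod)
  interpret q: group_hom G ?Q q
    using hom by unfold_locales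
  have UG: "U \<subseteq> carrier G"
    using U(1) by (rule subgroup.subset)
  have qU: "subgroup (q ` U) ?Q"
    using U(1) by (rule q.subgroup_img_is_subgroup)
  have quot: "quotient_map T ?S q"
    unfolding S by (rule quotient_map_quotient_topology)
  then have topS: "topspace ?S = carrier ?Q"
    using quotient_imp_surjective_map[OF quot] by (simp add: q Q topspace_eq_carrier carrier_FactGroup)
  have open_q: "open_map T ?S q"
    unfolding S q by (rule open_map_quotient_topology[OF K.normal_axioms])
  have ring: "cring ?R"
    using prime_gt_1_nat[OF p] by (intro residues.cring) (simp add: residues_def)
  have kernel: "kernel (G\<lparr>carrier := U\<rparr>) (?Q\<lparr>carrier := q ` U\<rparr>) q = K"
    using U(3) UG coset_join1[OF _ _ K.subgroup_axioms] coset_join2[OF _ K.subgroup_axioms]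
    by (auto simp: kernel_def q Q K_def)
  show ?thesis
  proof (intro inflation_setting.intro inflation_setting_axioms.intro cochain_setting.intro
      cochain_setting_axioms.intro)
    show "cring ?R" "cring ?R"
      by (fact ring)+
    show "group (G\<lparr>carrier := U\<rparr>)" "group (?Q\<lparr>carrier := q ` U\<rparr>)"
      using U(1) qU by (auto intro: subgroup_imp_group Q.subgroup_imp_group)
    show "topspace (subtopology T U) = carrier (G\<lparr>carrier := U\<rparr>)"
      using UG by (auto simp: topspace_eq_carrier)
    show "topspace (subtopology ?S (q ` U)) = carrier (?Q\<lparr>carrier := q ` U\<rparr>)"
      using subgroup.subset[OF qU] by (auto simp: topS)
    show "q \<in> hom (G\<lparr>carrier := U\<rparr>) (?Q\<lparr>carrier := q ` U\<rparr>)"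
      using UG by (auto simp: hom_def subset_iff)
    show "q ` carrier (G\<lparr>carrier := U\<rparr>) = carrier (?Q\<lparr>carrier := q ` U\<rparr>)"
      by simp
    show "continuous_map (subtopology T U) (subtopology ?S (q ` U)) q"
      using quotient_imp_continuous_map[OF quot]
      by (auto simp: continuous_map_in_subtopology continuous_map_from_subtopology)
    show "open_map (subtopology T U) (subtopology ?S (q ` U)) q"
      unfolding open_map_def
    proof (intro allI impI)
      fix W assume W: "openin (subtopology T U) W"
      then have "openin T W" "W \<subseteq> U"
        using U(2) by (auto simp: openin_open_subtopology)
      then have "openin ?S (q ` W)" "q ` W = q ` W \<inter> q ` U"
        using open_q by (auto simp: open_map_def)
      then show "openin (subtopology ?S (q ` U)) (q ` W)"
        by (metis openin_subtopology)
    qed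
    show "continuous_map (subtopology T U) (subtopology T U) (\<lambda>x. x \<otimes>\<^bsub>G\<lparr>carrier := U\<rparr>\<^esub> g)"
      if g: "g \<in> carrier (G\<lparr>carrier := U\<rparr>)" for g
    proof -
      have "g \<in> U" "g \<in> carrier G"
        using g UG by auto
      then show ?thesis
        using continuous_map_mult_right[of g] subgroup.m_closed[OF U(1)]
        by (auto simp: continuous_map_in_subtopology continuous_map_from_subtopology)
    qed
    show "h k = \<zero>\<^bsub>?R\<^esub>"
      if "continuous_map (subtopology T U) (discrete_topology (carrier ?R)) h"
        and "\<And>x y. x \<in> kernel (G\<lparr>carrier := U\<rparr>) (?Q\<lparr>carrier := q ` U\<rparr>) q \<Longrightarrow>
          y \<in> kernel (G\<lparr>carrier := U\<rparr>) (?Q\<lparr>carrier := q ` U\<rparr>) q \<Longrightarrow>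
          h (x \<otimes>\<^bsub>G\<lparr>carrier := U\<rparr>\<^esub> y) = h x \<oplus>\<^bsub>?R\<^esub> h y"
        and "k \<in> kernel (G\<lparr>carrier := U\<rparr>) (?Q\<lparr>carrier := q ` U\<rparr>) q" for h k
      using that pro_p_kernel_hom_trivial[OF p U(2,3), of h k]
      unfolding kernel K_def by (simp add: residue_ring_def)
  qed
qed

end

theorem proposition1p12:
  fixes G :: "('a, 'b) monoid_scheme" and T :: "'a topology" and p :: nat
  assumes "prime p" and "profinite_group G T"
  shows "Kijima_Nishi p G T \<longleftrightarrow>
    Kijima_Nishi p (max_pro_p_quotient p G T) (max_pro_p_quotient_topology p G T)"
proof -
  interpret profinite_group G T by fact
  let ?K = "pro_p_kernel p G T" and ?q = "\<lambda>g. pro_p_kernel p G T #>\<^bsub>G\<^esub> g"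
  let ?Q = "max_pro_p_quotient p G T" and ?S = "max_pro_p_quotient_topology p G T"
  let ?R = "residue_ring (int p)"
  interpret K: normal ?K G
    using assms(1) by (rule pro_p_kernel_normal)
  have surj: "?q ` carrier G = carrier ?Q"
    by (simp add: max_pro_p_quotient_def carrier_FactGroup)
  \<comment> \<open>The setting for the whole group is the case U = G, once the trivial record
    updates and subspace topologies are simplified away.\<close>
  have "inflation_setting ?R (G\<lparr>carrier := carrier G\<rparr>) (subtopology T (topspace T))
      (?Q\<lparr>carrier := ?q ` carrier G\<rparr>) (subtopology ?S (?q ` carrier G)) ?q"
    using inflation_setting_pro_p[OF assms(1) subgroup_self _ K.subset] openin_topspace[of T]
    by (simp add: topspace_eq_carrier)
  moreover have "subtopology ?S (?q ` carrier G) = ?S"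
    using quotient_imp_surjective_map[OF quotient_map_quotient_topology[of T ?q]]
    by (metis max_pro_p_quotient_topology_def subtopology_topspace topspace_eq_carrier)
  ultimately have setting: "inflation_setting ?R G T ?Q ?S ?q"
    by (simp add: surj)
  then interpret I: inflation_setting ?R G T ?Q ?S ?q .
  have kernel: "kernel G ?Q ?q = ?K"
    using coset_join1[OF _ _ K.subgroup_axioms] coset_join2[OF _ K.subgroup_axioms] K.subset
    by (auto simp: kernel_def max_pro_p_quotient_def)
  let ?KN = "\<lambda>G T U. corestriction ?R 1 G T U ` cup_radical p (G\<lparr>carrier := U\<rparr>) (subtopology T U)
    = cup_radical p G T"
  have iff: "?KN G T U \<longleftrightarrow> ?KN ?Q ?S (?q ` U)" if "U \<lhd> G" "openin T U" "?K \<subseteq> U" for U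
    using corestriction_radical_inflation_iff[OF setting
        inflation_setting_pro_p[OF assms(1) normal_imp_subgroup[OF that(1)] that(2,3)]
        normal_imp_subgroup[OF that(1)]] that(3) by (simp add: kernel)
  have index: "card (rcosets\<^bsub>?Q\<^esub> (?q ` U)) = card (rcosets\<^bsub>G\<^esub> U)" if "U \<lhd> G" "?K \<subseteq> U" for U
    using I.q.card_rcosets_image[OF surj that(1)] that(2) by (simp add: kernel)
  \<comment> \<open>Index p is p^1, so such a \<open>U\<close> is among the open normal subgroups
    whose intersection is \<open>?K\<close>.\<close>
  have K_le: "?K \<subseteq> U" if "U \<lhd> G" "openin T U" "card (rcosets\<^bsub>G\<^esub> U) = p" for U
  proof -
    have "open_p_normal p G T U"
      using that open_p_normal_iff_index[OF assms(1), of U] power_one_right[of p] by metis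
    then show ?thesis
      using pro_p_kernel_eq_Inter[OF assms(1)] by blast
  qed
  show ?thesis
  proof
    assume KN: "Kijima_Nishi p G T"
    show "Kijima_Nishi p ?Q ?S"
      unfolding Kijima_Nishi_def
    proof (intro allI impI)
      fix V assume V: "V \<lhd> ?Q" "openin ?S V" "card (rcosets\<^bsub>?Q\<^esub> V) = p"
      \<comment> \<open>The preimage of \<open>V\<close> contains \<open>?K\<close>, has the same
        index as \<open>V\<close>, and maps back onto \<open>V\<close> by surjectivity, so the
        property of \<open>G\<close> at \<open>?U\<close> is the property of the quotient at
        \<open>V\<close>.\<close>
      let ?U = "{g \<in> carrier G. ?q g \<in> V}"
      have "V \<subseteq> ?q ` carrier G"
        using subgroup.subset[OF normal_imp_subgroup[OF V(1)]] surj by simp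
      then have V_eq: "?q ` ?U = V"
        by blast
      have U: "?U \<lhd> G" "openin T ?U"
        using I.q.normal_preimage[OF V(1)] V(2)
        by (simp_all add: max_pro_p_quotient_topology_def openin_quotient_topology topspace_eq_carrier)
      have K_U: "?K \<subseteq> ?U"
      proof
        fix x assume "x \<in> ?K"
        then have "x \<in> kernel G ?Q ?q"
          by (simp add: kernel)
        then show "x \<in> ?U"
          using subgroup.one_closed[OF normal_imp_subgroup[OF V(1)]] by (simp add: kernel_def)
      qed
      have "card (rcosets\<^bsub>G\<^esub> ?U) = p"
        using index[OF U(1) K_U] V(3) unfolding V_eq by simp
      then show "?KN ?Q ?S V"
        using KN U iff[OF U K_U] unfolding Kijima_Nishi_def V_eq by blast
    qed
  next
    assume KN: "Kijima_Nishi p ?Q ?S"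
    show "Kijima_Nishi p G T"
      unfolding Kijima_Nishi_def
    proof (intro allI impI)
      fix U assume U: "U \<lhd> G" "openin T U" "card (rcosets\<^bsub>G\<^esub> U) = p"
      have K_U: "?K \<subseteq> U"
        using U by (rule K_le)
      have "?q ` U \<lhd> ?Q"
        using normal.surj_hom_normal_subgroup[OF U(1) I.q.group_hom_axioms surj] .
      moreover have "openin ?S (?q ` U)"
        using I.q_open U(2) by (simp add: open_map_def)
      moreover have "card (rcosets\<^bsub>?Q\<^esub> (?q ` U)) = p"
        using index[OF U(1) K_U] U(3) by simp
      ultimately have "?KN ?Q ?S (?q ` U)"
        using KN unfolding Kijima_Nishi_def by blast
      then show "?KN G T U"
        using iff[OF U(1,2) K_U] by simp
    qed
  qed
qed

end
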